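(* Let $g=\sum_{n\ge 0}x^{n^{2}}\in\mathbb{Z}/2[[x]]$, write $\frac{1}{g}=\sum_{i\ge 0}b_{i}x^{i}$ with $b_{i}\in\mathbb{Z}/2$, and let $B=\{n\ge 0: b_{n}=1\}$. If $n\equiv 7\pmod{16}$ and three or more distinct primes occur to odd exponent in the prime factorization of $n$, then $n\notin B$. Furthermore, the number of $n\in B$ with $n\le y$ and $n\equiv 7\pmod{16}$ is $O\!\left(y\log\log(y)/\log(y)\right)$ as $y\to\infty$.
   Context: $\mathbb{Z}/2[[x]]$ is the ring of formal power series over the field with two elements; $g$ has constant term $1$ and so is invertible there. *)

theory Defs
  imports
    Complex_Main
    "HOL-Library.Z2"
    "HOL-Library.Landau_Symbols"
    "HOL-Computational_Algebra.Computational_Algebra"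
    "HOL-Number_Theory.Cong"
begin

text \<open>The type \<open>bit\<close> of \<open>HOL-Library.Z2\<close> is the field with two elements. The infinite sum is
  taken in the \<open>X\<close>-adic topology of \<open>bit fps\<close>.\<close>

definition g :: "bit fps" where
  "g = (\<Sum>n. fps_X ^ (n\<^sup>2))"

definition B :: "nat set" where
  "B = {n. fps_nth (inverse g) n = 1}"

text \<open>The series converges, so \<open>suminf\<close> is meaningful, and \<open>g\<close> has constant term 1, so
  \<open>inverse g\<close> is its multiplicative inverse.\<close>

lemma g_sums: "(\<lambda>n. fps_X ^ (n\<^sup>2)) sums (Abs_fps (\<lambda>k. of_bool (\<exists>n. k = n\<^sup>2)) :: bit fps)"
  unfolding sums_def
proof (rule tendsto_fpsI)
  fix k :: nat
  have "fps_nth (\<Sum>n<N. fps_X ^ (n\<^sup>2)) k = (of_bool (\<exists>n. k = n\<^sup>2) :: bit)" if "N > k" for N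
  proof (cases "\<exists>n. k = n\<^sup>2")
    case True
    then obtain m where m: "k = m\<^sup>2" by blast
    have "m \<le> k" unfolding m by (simp add: power2_eq_square)
    with that have "m \<in> {..<N}" by simp
    have "fps_nth (\<Sum>n<N. fps_X ^ (n\<^sup>2)) k = (\<Sum>n<N. if n = m then 1 else 0 :: bit)"
      unfolding fps_sum_nth m by (intro sum.cong) (auto simp: fps_X_power_nth power2_eq_iff_nonneg)
    also have "\<dots> = 1" using \<open>m \<in> {..<N}\<close> by (subst sum.delta) auto
    finally show ?thesis using True by simp
  next
    case False
    then show ?thesis by (auto simp: fps_sum_nth fps_X_power_nth intro!: sum.neutral)
  qed
  then show "\<forall>\<^sub>F N in sequentially. fps_nth (\<Sum>n<N. fps_X ^ (n\<^sup>2)) k =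
      fps_nth (Abs_fps (\<lambda>k. of_bool (\<exists>n. k = n\<^sup>2)) :: bit fps) k"
    by (intro eventually_mono[OF eventually_gt_at_top[of k]]) simp
qed

lemma fps_nth_g: "fps_nth g k = of_bool (\<exists>n. k = n\<^sup>2)"
  unfolding g_def using sums_unique[OF g_sums] by (metis fps_nth_Abs_fps)

lemma g_mult_inverse: "g * inverse g = 1"
proof -
  have "fps_nth g 0 \<noteq> 0" by (simp add: fps_nth_g)
  then show ?thesis by (metis inverse_mult_eq_1')
qed

end

(*
Write G for the sum of x^(a^2) over odd a > 0, so that g = G + g^4 modulo 2. Splitting G = G1 + G5
according to a = +-1 or +-3 (mod 8), the rotation a^2 + b^2 = 2 u^2 + 8 v^2 gives G1 G5 = G^10, while
h = g^8 + g^16 satisfies h^2 + h = G^8. Hence G5 and G h are roots of the same quadratic equation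
z^2 + G z = G^10, and in fact G5 = G h. It follows that 1/g and G^7 = G G^2 G^4 have the same
coefficients at the exponents n = 7 (mod 16), so b_n is the parity of the number of positive
solutions of a^2 + 2 b^2 + 4 c^2 = n. Adding a term 8 d^2 with d in Z does not change this parity,
and rotations turn the resulting count into sigma(n)/8 by the theorem on four odd squares. That
theorem is obtained from the logarithmic derivative of the theta series, for which an involution in
the style of Zagier is needed. Finally 16 divides sigma(n) if n = 3 (mod 4) and three primes occur to
odd exponent, since one of them is 3 modulo 4. The counting statement follows from Chebyshev's upper
bound, as n must be a square times a product of one or two primes.
*)

theory Submission
  imports Defs "HOL-Real_Asymp.Real_Asymp"
begin

section \<open>Generating functions of representation numbers\<close>

text \<open>Frobenius isolates the class 7 modulo 16, since multiplying by u^(2^k) moves exponents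
  only by multiples of 2^k. Expanding g^7 in 1/g = g^7 (1/g)^8 leaves G^7 (1/g)^8 as the one
  dangerous term: its eighth power controls exponents modulo 8 only. The identity G5 = G (g^8 +
  g^16), multiplied by (1/g)^16, reads G (1/g)^8 = G + G5 (1/g)^16 and trades that eighth power for
  a sixteenth. The exponents of G5 are 9 modulo 16, so the correction G5 G^6 (1/g)^16 lies in the
  class 9 + 2 + 4 = 15, and G^7 alone remains. In sigma(n)/8 the 8 is 2 * 4: two pairs of squares
  that can be exchanged, and two free signs. For the counting statement, n = m^2 p q with p < q is
  cut at m = y^(1/8). Above the cut the factor m^2 alone saves a power of y. Below it q ranges up to
  y / (m^2 p) >= y^(1/4), so Chebyshev's bound loses only a constant in the logarithm, and summing
  1/p over primes produces log log y.\<close>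

definition rep_series :: "'a set \<Rightarrow> ('a \<Rightarrow> 'b::comm_ring_1) \<Rightarrow> ('a \<Rightarrow> int) \<Rightarrow> 'b fps" where
  "rep_series I w f = Abs_fps (\<lambda>n. \<Sum>a | a \<in> I \<and> f a = int n. w a)"

text \<open>\<open>sum\<close> over an infinite set is 0, so \<open>rep_series\<close> is a genuine
  generating function only under this condition. Nonnegativity ensures that no element is lost to a
  negative exponent when series are multiplied.\<close>

definition finite_sublevels :: "'a set \<Rightarrow> ('a \<Rightarrow> int) \<Rightarrow> bool" where
  "finite_sublevels I f \<longleftrightarrow> (\<forall>a\<in>I. f a \<ge> 0) \<and> (\<forall>n. finite {a \<in> I. f a \<le> int n})"

lemma fps_nth_rep_series: "fps_nth (rep_series I w f) n = (\<Sum>a | a \<in> I \<and> f a = int n. w a)"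
  by (simp add: rep_series_def)

lemma finite_sublevelsD:
  assumes "finite_sublevels I f"
  shows "finite {a \<in> I. f a = int n}"
proof -
  have "finite {a \<in> I. f a \<le> int n}" using assms unfolding finite_sublevels_def by blast
  then show ?thesis by (rule finite_subset[rotated]) auto
qed

lemma finite_sublevels_Times:
  assumes "finite_sublevels I f" "finite_sublevels J h"
  shows "finite_sublevels (I \<times> J) (\<lambda>(a,b). f a + h b)"
proof -
  have "finite {p \<in> I \<times> J. (\<lambda>(a,b). f a + h b) p \<le> int n}" for n
  proof (rule finite_subset)
    show "{p \<in> I \<times> J. (\<lambda>(a,b). f a + h b) p \<le> int n} \<subseteq> 
       {a \<in> I. f a \<le> int n} \<times> {b \<in> J. h b \<le> int n}"
      using assms unfolding finite_sublevels_def by force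
    show "finite ({a \<in> I. f a \<le> int n} \<times> {b \<in> J. h b \<le> int n})"
      using assms unfolding finite_sublevels_def by auto
  qed
  moreover have "\<forall>p\<in>I \<times> J. 0 \<le> (\<lambda>(a,b). f a + h b) p"
    using assms unfolding finite_sublevels_def by auto
  ultimately show ?thesis unfolding finite_sublevels_def by blast
qed

lemma rep_series_mult:
  assumes I: "finite_sublevels I f" and J: "finite_sublevels J h"
  shows "rep_series I w f * rep_series J v h =
    rep_series (I \<times> J) (\<lambda>(a,b). w a * v b) (\<lambda>(a,b). f a + h b)"
proof (rule fps_ext)
  fix n
  define T where "T = {p. p \<in> I \<times> J \<and> (\<lambda>(a,b). f a + h b) p = int n}"
  have finT: "finite T" unfolding T_def by (rule finite_sublevelsD[OF finite_sublevels_Times[OF I J]])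
  have fnn: "f a \<ge> 0" if "a \<in> I" for a using that I unfolding finite_sublevels_def by blast
  have hnn: "h b \<ge> 0" if "b \<in> J" for b using that J unfolding finite_sublevels_def by blast
  have "fps_nth (rep_series (I \<times> J) (\<lambda>(a,b). w a * v b) (\<lambda>(a,b). f a + h b)) n =
     (\<Sum>p\<in>T. case p of (a,b) \<Rightarrow> w a * v b)"
    by (simp add: fps_nth_rep_series T_def)
  \<comment> \<open>Pairs are grouped by the value of their first component; it is at most n because
    the second value is nonnegative.\<close>
  also have "\<dots> = (\<Sum>i\<in>{0..n}. \<Sum>p | p \<in> T \<and> nat (f (fst p)) = i. case p of (a,b) \<Rightarrow> w a * v b)"
    by (rule sum.group[symmetric]) (use finT hnn in \<open>force simp: T_def\<close>)+
  also have "\<dots> = (\<Sum>i\<in>{0..n}. fps_nth (rep_series I w f) i * fps_nth (rep_series J v h) (n - i))"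
  proof (rule sum.cong[OF refl])
    fix i assume i: "i \<in> {0..n}"
    have "{p. p \<in> T \<and> nat (f (fst p)) = i} = {a \<in> I. f a = int i} \<times> {b \<in> J. h b = int (n - i)}"
      using i fnn hnn by (auto simp: T_def of_nat_diff)
    then show "(\<Sum>p | p \<in> T \<and> nat (f (fst p)) = i. case p of (a,b) \<Rightarrow> w a * v b) =
       fps_nth (rep_series I w f) i * fps_nth (rep_series J v h) (n - i)"
      by (simp add: fps_nth_rep_series sum_product sum.cartesian_product)
  qed
  finally show "fps_nth (rep_series I w f * rep_series J v h) n =
     fps_nth (rep_series (I \<times> J) (\<lambda>(a,b). w a * v b) (\<lambda>(a,b). f a + h b)) n"
    by (simp add: fps_mult_nth)
qed

lemma finite_sublevels_square:
  assumes "c > 0"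
  shows "finite_sublevels I (\<lambda>a::int. c * a\<^sup>2)"
proof -
  have "{a \<in> I. c * a\<^sup>2 \<le> int n} \<subseteq> {- int n .. int n}" for n
  proof clarsimp
    fix a assume "c * a\<^sup>2 \<le> int n"
    moreover have "\<bar>a\<bar> \<le> a\<^sup>2"
    proof (cases "a = 0")
      case False
      then have "\<bar>a\<bar> * 1 \<le> \<bar>a\<bar> * \<bar>a\<bar>" by (intro mult_left_mono) auto
      then show ?thesis by (simp add: power2_eq_square)
    qed simp
    moreover have "a\<^sup>2 \<le> c * a\<^sup>2" using assms by (simp add: mult_le_cancel_right1)
    ultimately show "- int n \<le> a \<and> a \<le> int n" by linarith
  qed
  then show ?thesis using assms unfolding finite_sublevels_def
    by (auto intro: finite_subset)
qed


lemma rep_series_union: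
  assumes "finite_sublevels I f" "finite_sublevels J f" "I \<inter> J = {}"
  shows "rep_series (I \<union> J) w f = rep_series I w f + rep_series J w f"
proof (rule fps_ext)
  fix n
  have "{a \<in> I \<union> J. f a = int n} = {a \<in> I. f a = int n} \<union> {a \<in> J. f a = int n}" by auto
  moreover have "sum w ({a \<in> I. f a = int n} \<union> {a \<in> J. f a = int n}) =
      sum w {a \<in> I. f a = int n} + sum w {a \<in> J. f a = int n}"
    using assms by (intro sum.union_disjoint finite_sublevelsD) auto
  ultimately show "fps_nth (rep_series (I \<union> J) w f) n = fps_nth (rep_series I w f + rep_series J w f) n"
    by (simp add: fps_nth_rep_series)
qed

text \<open>Changes of variables enter through this rule: an identity between theta series becomes a
  bijection of index sets that respects the quadratic forms.\<close>

lemma rep_series_reindex: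
  assumes "bij_betw \<phi> J I" "\<And>b. b \<in> J \<Longrightarrow> f (\<phi> b) = h b" "\<And>b. b \<in> J \<Longrightarrow> w (\<phi> b) = v b"
  shows "rep_series I w f = rep_series J v h"
proof (rule fps_ext)
  fix n
  have "bij_betw \<phi> {b \<in> J. h b = int n} {a \<in> I. f a = int n}"
    using assms(1,2) unfolding bij_betw_def inj_on_def by (auto simp: image_iff)
  then have "(\<Sum>b | b \<in> J \<and> h b = int n. w (\<phi> b)) = (\<Sum>a | a \<in> I \<and> f a = int n. w a)"
    by (rule sum.reindex_bij_betw)
  then show "fps_nth (rep_series I w f) n = fps_nth (rep_series J v h) n"
    using assms(3) by (simp add: fps_nth_rep_series)
qed

lemma rep_series_nonzeroD:
  assumes "fps_nth (rep_series I w f) n \<noteq> 0"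
  obtains a where "a \<in> I" "f a = int n"
proof -
  have "{a. a \<in> I \<and> f a = int n} \<noteq> {}"
    using assms unfolding fps_nth_rep_series by (metis sum.empty)
  then show ?thesis using that by blast
qed

section \<open>Power series over the field with two elements\<close>

lemma bit_fps_two_eq_0 [simp]: "(2 :: bit fps) = 0"
proof -
  have "(1 + 1 :: bit fps) = 0" by (rule fps_ext) (simp only: fps_add_nth, simp)
  then show ?thesis by simp
qed

lemma bit_fps_add_self [simp]: "(f :: bit fps) + f = 0"
  by (metis bit_fps_two_eq_0 mult_2 mult_zero_left)

text \<open>The reflection i -> n - i pairs off the terms of the convolution, and paired terms
  cancel in characteristic 2. Only a fixed point i = n / 2 survives.\<close>

lemma bit_fps_square_nth:
  "fps_nth ((f :: bit fps)\<^sup>2) n = (if even n then fps_nth f (n div 2) else 0)"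
proof -
  define L where "L = {i. i \<le> n \<and> 2 * i < n}"
  define R where "R = {i. i \<le> n \<and> 2 * i > n}"
  define D where "D = {i. i \<le> n \<and> 2 * i = n}"
  let ?t = "\<lambda>i. fps_nth f i * fps_nth f (n - i)"
  have fin: "finite L" "finite R" "finite D"
    unfolding L_def R_def D_def by (auto intro: finite_subset[of _ "{..n}"])
  have "{0..n} = (L \<union> R) \<union> D" unfolding L_def R_def D_def by auto
  then have "fps_nth (f\<^sup>2) n = sum ?t (L \<union> R \<union> D)"
    by (simp add: power2_eq_square fps_mult_nth)
  also have "\<dots> = sum ?t L + sum ?t R + sum ?t D"
    using fin by (subst sum.union_disjoint; (subst sum.union_disjoint)?) (auto simp: L_def R_def D_def)
  also have "sum ?t R = sum ?t L"
    by (rule sum.reindex_bij_witness[of _ "\<lambda>i. n - i" "\<lambda>i. n - i"]) (auto simp: L_def R_def mult.commute)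
  also have "sum ?t D = (if even n then fps_nth f (n div 2) else 0)"
  proof (cases "even n")
    case True
    then have "D = {n div 2}" "n - n div 2 = n div 2" unfolding D_def by (auto)
    then show ?thesis using True by (cases "fps_nth f (n div 2)") auto
  next
    case False
    then have "D = {}" unfolding D_def by auto
    then show ?thesis using False by simp
  qed
  finally show ?thesis by simp
qed

lemma bit_fps_pow2_nth:
  "fps_nth ((f :: bit fps) ^ (2 ^ k)) n = (if 2 ^ k dvd n then fps_nth f (n div 2 ^ k) else 0)"
proof (induction k arbitrary: n)
  case (Suc k)
  have "f ^ (2 ^ Suc k) = (f ^ (2 ^ k))\<^sup>2" by (simp add: power_mult[symmetric] mult.commute)
  then have "fps_nth (f ^ (2 ^ Suc k)) n = (if even n then fps_nth (f ^ (2 ^ k)) (n div 2) else 0)"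
    by (simp only: bit_fps_square_nth)
  also have "\<dots> = (if 2 ^ Suc k dvd n then fps_nth f (n div 2 ^ Suc k) else 0)"
    using Suc by (auto simp: div_mult2_eq elim!: dvd_mult_left) 
  finally show ?case .
qed simp

lemma bit_fps_square_add: "((f :: bit fps) + h)\<^sup>2 = f\<^sup>2 + h\<^sup>2"
proof -
  have "(f + h)\<^sup>2 = f\<^sup>2 + h\<^sup>2 + (f * h + f * h)" by (simp add: power2_eq_square algebra_simps)
  then show ?thesis by simp
qed

lemma bit_fps_pow2_add: "((f :: bit fps) + h) ^ (2 ^ k) = f ^ (2 ^ k) + h ^ (2 ^ k)"
proof (induction k)
  case (Suc k)
  have "u ^ (2 ^ Suc k) = (u ^ (2 ^ k))\<^sup>2" for u :: "bit fps" 
    by (simp add: power_mult[symmetric] mult.commute)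
  then show ?case by (simp add: Suc bit_fps_square_add)
qed simp

text \<open>By Frobenius a power 2^k costs no further variables: it only scales the form. This is
  why G^7 leads to three squares rather than seven.\<close>

lemma rep_series_pow2:
  "(rep_series I (\<lambda>_. 1 :: bit) f) ^ (2 ^ k) = rep_series I (\<lambda>_. 1) (\<lambda>a. 2 ^ k * f a)"
proof (rule fps_ext)
  fix n
  show "fps_nth (rep_series I (\<lambda>_. 1 :: bit) f ^ (2 ^ k)) n =
      fps_nth (rep_series I (\<lambda>_. 1) (\<lambda>a. 2 ^ k * f a)) n"
  proof (cases "2 ^ k dvd n")
    case True
    then obtain m where m: "n = 2 ^ k * m" by blast
    have "2 ^ k * f a = int n \<longleftrightarrow> f a = int m" for a unfolding m by simp
    then show ?thesis by (simp add: bit_fps_pow2_nth fps_nth_rep_series m)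
  next
    case False
    then have "2 ^ k * f a \<noteq> int n" for a
      by (metis dvd_triv_left of_nat_dvd_iff of_nat_numeral of_nat_power)
    then show ?thesis using False by (simp add: bit_fps_pow2_nth fps_nth_rep_series)
  qed
qed

text \<open>Used contrapositively, to discard terms in the expansion of 1/g by the residue classes
  of their exponents.\<close>

lemma fps_mult_pow2_nonzeroD:
  assumes "fps_nth (f * h ^ (2 ^ k) :: bit fps) n \<noteq> 0"
  obtains i j where "fps_nth f i \<noteq> 0" "n = i + 2 ^ k * j"
proof -
  have "\<exists>i\<in>{0..n}. fps_nth f i * fps_nth (h ^ (2 ^ k)) (n - i) \<noteq> 0"
    using assms unfolding fps_mult_nth by (meson sum.neutral)
  then obtain i where i: "i \<le> n" "fps_nth f i \<noteq> 0" "fps_nth (h ^ (2 ^ k)) (n - i) \<noteq> 0"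
    by auto
  then have "2 ^ k dvd n - i" by (auto simp: bit_fps_pow2_nth split: if_splits)
  then obtain j where "n - i = 2 ^ k * j" by blast
  then show ?thesis using i that[of i j] by simp
qed

section \<open>The reciprocal of the theta series\<close>

text \<open>Every odd square is \<open>a\<^sup>2\<close> for exactly one integer \<open>a \<equiv> 1 (mod 4)\<close>; working with these
  signed roots instead of positive ones turns the changes of variables below into linear maps.\<close>

definition odd_roots :: "int set" where
  "odd_roots = {a. a mod 4 = 1}"

lemma odd_rootsD: "a \<in> odd_roots \<Longrightarrow> odd a"
  unfolding odd_roots_def by clarsimp presburger

definition odd_square_series :: "'b::comm_ring_1 fps" where
  "odd_square_series = rep_series odd_roots (\<lambda>_. 1) power2"

abbreviation (input) G :: "bit fps" where "G \<equiv> odd_square_series"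

text \<open>Among signed roots, the residue 1 modulo 8 belongs to absolute values +-1 modulo 8 and
  the residue 5 to absolute values +-3. The squares of the latter are 9 modulo 16.\<close>

definition G1 :: "bit fps" where "G1 = rep_series {a::int. a mod 8 = 1} (\<lambda>_. 1) power2"
definition G5 :: "bit fps" where "G5 = rep_series {a::int. a mod 8 = 5} (\<lambda>_. 1) power2"

lemma finite_sublevels_square1: "finite_sublevels I (power2 :: int \<Rightarrow> int)"
  using finite_sublevels_square[of 1] by simp

lemma G_split: "G = G1 + G5"
proof -
  have "odd_roots = {a. a mod 8 = 1} \<union> {a. a mod 8 = 5}"
    unfolding odd_roots_def by (intro set_eqI iffI; simp; presburger)
  moreover have "{a::int. a mod 8 = 1} \<inter> {a. a mod 8 = 5} = {}" by auto
  ultimately show ?thesis unfolding odd_square_series_def G1_def G5_def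
    by (metis (no_types, lifting) rep_series_union[OF finite_sublevels_square1 finite_sublevels_square1])
qed

lemma g_eq_rep_series: "g = rep_series {0..} (\<lambda>_. 1) (power2 :: int \<Rightarrow> int)"
proof (rule fps_ext)
  fix n
  show "fps_nth g n = fps_nth (rep_series {0..} (\<lambda>_. 1) (power2 :: int \<Rightarrow> int)) n"
  proof (cases "\<exists>k. n = k\<^sup>2")
    case True
    then obtain k where k: "n = k\<^sup>2" by blast
    then have "a\<^sup>2 = int n \<longleftrightarrow> a = int k" if "a \<ge> 0" for a
      using power2_eq_iff_nonneg[OF that, of "int k"] by simp
    then have "{a. a \<in> {0..} \<and> a\<^sup>2 = int n} = {int k}" using k by auto
    then show ?thesis using True by (simp add: fps_nth_g fps_nth_rep_series)
  next
    case False
    have "{a. a \<in> {0..} \<and> a\<^sup>2 = int n} = {}"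
    proof safe
      fix a :: int assume "0 \<le> a" "a\<^sup>2 = int n"
      then have "int n = int ((nat a)\<^sup>2)" by simp
      then show "a \<in> {}" using False by (metis of_nat_eq_iff)
    qed
    then have "fps_nth (rep_series {0..} (\<lambda>_. 1 :: bit) (power2 :: int \<Rightarrow> int)) n = 0"
      unfolding fps_nth_rep_series by (simp only: sum.empty)
    then show ?thesis using False by (simp add: fps_nth_g)
  qed
qed

text \<open>The even squares are the numbers 4 k^2, whose generating function is g^4 by
  Frobenius.\<close>

lemma g_eq: "g = G + g ^ 4"
proof -
  have g4: "g ^ 4 = rep_series {a. a \<ge> 0 \<and> even a} (\<lambda>_. 1) (power2 :: int \<Rightarrow> int)"
  proof -
    have "g ^ 4 = rep_series {0..} (\<lambda>_. 1) (\<lambda>a::int. 4 * a\<^sup>2)"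
      unfolding g_eq_rep_series using rep_series_pow2[of _ _ 2] by simp
    also have "\<dots> = rep_series {a. a \<ge> 0 \<and> even a} (\<lambda>_. 1) power2"
    proof (rule sym, rule rep_series_reindex[of "\<lambda>a. 2 * a"])
      show "bij_betw (\<lambda>a. 2 * a) {0..} {a::int. a \<ge> 0 \<and> even a}"
        by (rule bij_betw_byWitness[where f' = "\<lambda>a. a div 2"]) auto
    qed (auto simp: power_mult_distrib)
    finally show ?thesis .
  qed
  have G: "G = rep_series {a. a \<ge> 0 \<and> odd a} (\<lambda>_. 1) (power2 :: int \<Rightarrow> int)"
    unfolding odd_square_series_def
  proof (rule rep_series_reindex[of "\<lambda>a. if a mod 4 = 1 then a else - a"])
    show "bij_betw (\<lambda>a. if a mod 4 = 1 then a else - a) {a. a \<ge> 0 \<and> odd a} odd_roots"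
    proof (rule bij_betw_byWitness[where f' = abs])
      have "(- a) mod 4 = 1" if "odd a" "a mod 4 \<noteq> 1" for a :: int using that by presburger
      then show "(\<lambda>a. if a mod 4 = 1 then a else - a) ` {a. a \<ge> 0 \<and> odd a} \<subseteq> odd_roots"
        by (auto simp: odd_roots_def)
      have "odd a" "(- a) mod 4 \<noteq> 1" if "a mod 4 = 1" for a :: int using that by presburger+
      then show "abs ` odd_roots \<subseteq> {a. a \<ge> 0 \<and> odd a}"
        "\<forall>a\<in>odd_roots. (if \<bar>a\<bar> mod 4 = 1 then \<bar>a\<bar> else - \<bar>a\<bar>) = a"
        by (auto simp: odd_roots_def abs_if)
    qed simp
  qed auto
  have "{0..} = {a::int. a \<ge> 0 \<and> odd a} \<union> {a. a \<ge> 0 \<and> even a}" by auto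
  moreover have "{a::int. a \<ge> 0 \<and> odd a} \<inter> {a. a \<ge> 0 \<and> even a} = {}" by auto
  ultimately have "g = rep_series {a. a \<ge> 0 \<and> odd a} (\<lambda>_. 1) (power2 :: int \<Rightarrow> int) +
      rep_series {a. a \<ge> 0 \<and> even a} (\<lambda>_. 1) power2"
    unfolding g_eq_rep_series
    by (metis (no_types, lifting) rep_series_union[OF finite_sublevels_square1 finite_sublevels_square1])
  then show ?thesis unfolding G g4 .
qed

text \<open>Numbers x = 1 and y = 5 modulo 8 satisfy x^2 + y^2 = 2 a^2 + 8 b^2 for a = -(x + y) / 2
  and b = (y - x) / 4 up to sign. As b is 1 modulo 4, 2 b is 2 modulo 8, so the residue of a modulo
  8 decides which of -a - 2 b and 2 b - a is 1 modulo 8 and which is 5.\<close>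

lemma G1_G5: "G1 * G5 = G\<^sup>2 * G ^ 8"
proof -
  have "G\<^sup>2 = rep_series odd_roots (\<lambda>_. 1) (\<lambda>a. 2 * a\<^sup>2)"
    "G ^ 8 = rep_series odd_roots (\<lambda>_. 1) (\<lambda>a. 8 * a\<^sup>2)"
    unfolding odd_square_series_def using rep_series_pow2[of _ _ 1] rep_series_pow2[of _ _ 3] by simp_all
  then have 1: "G\<^sup>2 * G ^ 8 = rep_series (odd_roots \<times> odd_roots) (\<lambda>(a,b). 1 * 1) (\<lambda>(a,b). 2 * a\<^sup>2 + 8 * b\<^sup>2)"
    by (simp only: rep_series_mult finite_sublevels_square zero_less_numeral)
  have 2: "G1 * G5 = rep_series ({a. a mod 8 = 1} \<times> {a. a mod 8 = 5}) (\<lambda>(a,b). 1 * 1) (\<lambda>(a,b). a\<^sup>2 + b\<^sup>2)"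
    unfolding G1_def G5_def by (simp only: rep_series_mult finite_sublevels_square1)
  show ?thesis unfolding 1 2
  proof (rule rep_series_reindex[where \<phi> = "\<lambda>(a,b). if a mod 8 = 5 then (- a - 2 * b, 2 * b - a)
      else (2 * b - a, - a - 2 * b)"])
    show "bij_betw (\<lambda>(a,b). if a mod 8 = 5 then (- a - 2 * b, 2 * b - a)
      else (2 * b - a, - a - 2 * b)) (odd_roots \<times> odd_roots) ({a. a mod 8 = 1} \<times> {a. a mod 8 = 5})"
(is "bij_betw ?f ?A ?B")
    proof (rule bij_betw_imageI)
      show "inj_on ?f ?A"
      proof (rule inj_onI)
        fix p q :: "int \<times> int"
        assume eq: "?f p = ?f q"
        \<comment> \<open>In both branches the coordinates add up to -2 a, which recovers a and with
          it the branch.\<close>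
        then have "fst p = fst q" by (simp split: if_splits prod.splits)
        then show "p = q" using eq by (simp split: if_splits prod.splits)
      qed
      show "?f ` ?A = ?B"
      proof (intro subset_antisym subsetI)
        fix p assume "p \<in> ?f ` ?A"
        then obtain a b where p: "p = ?f (a, b)" and ab: "a mod 4 = 1" "b mod 4 = 1"
          by (auto simp: odd_roots_def)
        obtain j where j: "b = 4 * j + 1" using ab(2) by (metis mult_div_mod_eq)
        show "p \<in> ?B"
        proof (cases "a mod 8 = 5")
          case True
          have "(- a - 2 * b) mod 8 = 1" "(2 * b - a) mod 8 = 5" using True unfolding j by presburger+
          then show ?thesis using True p by simp
        next
          case False
          then have "a mod 8 = 1" using ab(1) by presburger
          then have "(2 * b - a) mod 8 = 1" "(- a - 2 * b) mod 8 = 5" unfolding j by presburger+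
          then show ?thesis using False p by simp
        qed
      next
        fix p assume "p \<in> ?B"
        then obtain x y where p: "p = (x, y)" and "x mod 8 = 1" "y mod 8 = 5" by auto
        then obtain u v where uv: "x = 8 * u + 1" "y = 8 * v + 5" by (metis mult_div_mod_eq)
        \<comment> \<open>This is -(x + y) / 2. The witness for b below is (y - x) / 4 or its
          negative, whichever is 1 modulo 4.\<close>
        define a where "a = - 4 * (u + v) - 3"
        have a: "a mod 4 = 1" unfolding a_def by presburger
        have "\<exists>b. b mod 4 = 1 \<and> p = ?f (a, b)"
        proof (cases "even (v - u)")
          case True
          then obtain k where k: "v = u + 2 * k" by (metis diff_add_cancel add.commute evenE)
          have "(4 * k + 1) mod 4 = 1" "a mod 8 = 5" unfolding a_def k by presburger+
          then show ?thesis unfolding p uv by (intro exI[of _ "4 * k + 1"]) (simp add: k a_def)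
        next
          case False
          then obtain k where k: "v = u + 2 * k + 1" by (metis diff_add_cancel add.commute add.assoc oddE)
          have "(- 4 * k - 3) mod 4 = 1" "a mod 8 \<noteq> 5" unfolding a_def k by presburger+
          then show ?thesis unfolding p uv by (intro exI[of _ "- 4 * k - 3"]) (simp add: k a_def)
        qed
        then show "p \<in> ?f ` ?A" using a unfolding odd_roots_def by blast
      qed
    qed
  qed (auto simp: power2_eq_square algebra_simps split: if_splits)
qed

text \<open>In a domain of characteristic 2 the two roots of the quadratic equation differ by
  \<open>G\<close>. The coefficient of x tells them apart: it is 1 in \<open>G\<close>, but 0 in
  \<open>G5\<close>, which starts at x^9, and 0 in the product of \<open>G\<close> with g^8 + g^16,
  both of whose factors have constant term 0.\<close>

lemma G5_eq: "G5 = G * (g ^ 8 + g ^ 16)"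
proof -
  define h where "h = g ^ 8 + g ^ 16"
  define D where "D = G5 + G * h"
  have "g ^ 8 = G ^ 8 + (g ^ 4) ^ 8"
    using arg_cong[OF g_eq, of "\<lambda>u. u ^ 8"] bit_fps_pow2_add[of G "g ^ 4" 3] by simp
  then have g8: "g ^ 8 = G ^ 8 + g ^ 32" by (simp flip: power_mult)
  \<comment> \<open>Terms that cancel in characteristic 2 are collected behind a factor 2, so that
    each equation is plain ring algebra until that factor is set to 0.\<close>
  have "h * h + h = g ^ 32 + g ^ 8 + 2 * (g ^ 16 + g ^ 24)"
    unfolding h_def by (simp add: algebra_simps flip: power_add)
  also have "\<dots> = G ^ 8 + 2 * g ^ 32" by (simp add: g8)
  finally have h: "h * h + h = G ^ 8" by simp
  have "D * (D + G) = (G5 + G) * G5 + G\<^sup>2 * (h * h + h) + 2 * (G5 * G * h)"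
    unfolding D_def by (simp add: algebra_simps power2_eq_square)
  also have "(G5 + G) * G5 = G1 * G5 + 2 * (G5 * G5)"
    by (simp add: G_split algebra_simps)
  also have "G1 * G5 = G\<^sup>2 * (h * h + h)" unfolding h by (rule G1_G5)
  finally have "D * (D + G) = 0" by simp
  moreover have "fps_nth (D + G) 1 \<noteq> 0"
  proof -
    have sq1: "a\<^sup>2 = 1 \<longleftrightarrow> a = 1 \<or> a = - 1" for a :: int by (rule power2_eq_1_iff)
    have "fps_nth G5 1 = 0"
    proof (rule ccontr)
      assume "fps_nth G5 1 \<noteq> 0"
      then obtain a :: int where "a mod 8 = 5" "a\<^sup>2 = 1"
        unfolding G5_def by (rule rep_series_nonzeroD) simp
      then show False unfolding sq1 by auto
    qed
    moreover have "fps_nth G 0 = 0"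
    proof (rule ccontr)
      assume "fps_nth G 0 \<noteq> 0"
      then obtain a where "a \<in> odd_roots" "a\<^sup>2 = int 0"
        unfolding odd_square_series_def by (rule rep_series_nonzeroD)
      then show False by (simp add: odd_roots_def)
    qed
    moreover have "fps_nth G 1 = 1"
    proof -
      have "{a. a \<in> odd_roots \<and> a\<^sup>2 = int 1} = {1}" unfolding odd_roots_def using sq1 by auto
      then show ?thesis unfolding odd_square_series_def fps_nth_rep_series by simp
    qed
    moreover have "fps_nth h 0 = 0" unfolding h_def by (simp add: fps_nth_g)
    ultimately show ?thesis unfolding D_def by (simp add: fps_mult_nth)
  qed
  ultimately have "D = 0" by (metis fps_zero_nth mult_eq_0_iff)
  then have "G5 + G * h + G * h = G * h" unfolding D_def by simp
  then show ?thesis unfolding h_def[symmetric] by (simp add: add.assoc)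
qed

text \<open>The terms come from b = b^8 g^7 with b = 1/g and g^7 = g g^2 g^4, where g = G + g^4, g^2
  = G^2 + g^8 and g^4 = G^4 + g^16. Apart from powers of \<open>G\<close> and \<open>G5\<close>,
  only 2^k-th powers occur, so that residues of exponents can be read off.\<close>

lemma inverse_g_decomp:
  "inverse g = G * (G\<^sup>2 * G ^ 4) + (G5 * (G\<^sup>2 * G ^ 4)) * (inverse g) ^ 16 + (G * G\<^sup>2) * g ^ 8
     + G * G ^ 4 + G * g ^ 16 + g\<^sup>2"
proof -
  define b where "b = inverse g"
  have gb: "g * b = 1" unfolding b_def by (rule g_mult_inverse)
  have gb': "g ^ k * b ^ k = 1" for k by (simp add: gb flip: power_mult_distrib)
  have g2: "g\<^sup>2 = G\<^sup>2 + g ^ 8" 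
    using arg_cong[OF g_eq, of "\<lambda>u. u\<^sup>2"] bit_fps_pow2_add[of G "g ^ 4" 1] by (simp flip: power_mult)
  have g4: "g ^ 4 = G ^ 4 + g ^ 16" 
    using arg_cong[OF g_eq, of "\<lambda>u. u ^ 4"] bit_fps_pow2_add[of G "g ^ 4" 2] by (simp flip: power_mult)
  have "g ^ 7 = g * (g\<^sup>2 * g ^ 4)" by (simp flip: power_add power_Suc)
  also have "\<dots> = G * (g\<^sup>2 * g ^ 4) + g ^ 4 * (g\<^sup>2 * g ^ 4)"
    by (subst (1) g_eq) (simp add: algebra_simps)
  also have "g ^ 4 * (g\<^sup>2 * g ^ 4) = g ^ 10" by (simp flip: power_add)
  also have "g\<^sup>2 * g ^ 4 = (G\<^sup>2 + g ^ 8) * (G ^ 4 + g ^ 16)" using g2 g4 by simp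
  finally have g7: "g ^ 7 = G * (G\<^sup>2 * G ^ 4) + (G * G\<^sup>2) * g ^ 16 + (G * G ^ 4) * g ^ 8 + G * g ^ 24 + g ^ 10"
    by (simp add: algebra_simps flip: power_add)
  have "b = b ^ 8 * g ^ 7"
  proof -
    have "b ^ 8 * g ^ 7 = b * (g ^ 7 * b ^ 7)" by (simp add: algebra_simps flip: power_Suc)
    then show ?thesis by (simp add: gb')
  qed
  also have "\<dots> = (G * (G\<^sup>2 * G ^ 4)) * b ^ 8 + (G * G\<^sup>2) * g ^ 8 * (g ^ 8 * b ^ 8) + (G * G ^ 4) * (g ^ 8 * b ^ 8)
      + G * g ^ 16 * (g ^ 8 * b ^ 8) + g\<^sup>2 * (g ^ 8 * b ^ 8)"
    unfolding g7 by (simp add: algebra_simps flip: power_add)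
  finally have b: "b = (G * (G\<^sup>2 * G ^ 4)) * b ^ 8 + (G * G\<^sup>2) * g ^ 8 + G * G ^ 4 + G * g ^ 16 + g\<^sup>2"
    by (simp add: gb')
  \<comment> \<open>Multiplying the formula for \<open>G5\<close> by b^16 turns g^8 + g^16 into b^8
    + 1.\<close>
  have "(G5 * (G\<^sup>2 * G ^ 4)) * b ^ 16 = G * (G\<^sup>2 * G ^ 4) * (b ^ 8 * (g ^ 8 * b ^ 8) + g ^ 16 * b ^ 16)"
    unfolding G5_eq by (simp add: algebra_simps flip: power_add)
  also have "\<dots> = G * (G\<^sup>2 * G ^ 4) * b ^ 8 + G * (G\<^sup>2 * G ^ 4)"
    by (simp add: gb' algebra_simps)
  \<comment> \<open>One summand changes sides. Over a general commutative ring this costs the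
    doubled term written out here, which vanishes in characteristic 2.\<close>
  finally have "(G * (G\<^sup>2 * G ^ 4)) * b ^ 8 = G * (G\<^sup>2 * G ^ 4) + (G5 * (G\<^sup>2 * G ^ 4)) * b ^ 16
     + 2 * (- (G * (G\<^sup>2 * G ^ 4)))" by (simp add: algebra_simps del: bit_fps_two_eq_0)
  then have "(G * (G\<^sup>2 * G ^ 4)) * b ^ 8 = G * (G\<^sup>2 * G ^ 4) + (G5 * (G\<^sup>2 * G ^ 4)) * b ^ 16"
    by simp
  with b show ?thesis unfolding b_def by simp
qed

section \<open>Residue classes of exponents\<close>

lemma odd_square_mod_8: "odd (a::int) \<Longrightarrow> a\<^sup>2 mod 8 = 1"
proof -
  assume "odd a"
  then obtain k where k: "a = 2 * k + 1" by (rule oddE)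
  obtain m where "k * (k + 1) = 2 * m" by (metis dvdE even_mult_iff even_plus_one_iff)
  then have "a\<^sup>2 = 8 * m + 1" unfolding k by (simp add: power2_eq_square algebra_simps)
  then show ?thesis by (simp only: mod_mult_self4) simp
qed

lemma odd_square_mod_16_5: "(a::int) mod 8 = 5 \<Longrightarrow> a\<^sup>2 mod 16 = 9"
proof -
  assume "a mod 8 = 5"
  then obtain k where "a = 8 * k + 5" by (metis mult_div_mod_eq)
  then have "a\<^sup>2 = 16 * (4 * k\<^sup>2 + 5 * k + 1) + 9" by (simp add: power2_eq_square algebra_simps)
  then show ?thesis by (simp only: mod_mult_self4) simp
qed

lemma G_pow2: "G ^ (2 ^ k) = rep_series odd_roots (\<lambda>_. 1) (\<lambda>a. 2 ^ k * a\<^sup>2)"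
  unfolding odd_square_series_def by (rule rep_series_pow2)

lemma G_pow2_nonzeroD:
  assumes "fps_nth (G ^ (2 ^ k)) n \<noteq> 0"
  shows "n mod 2 ^ (k + 3) = 2 ^ k"
proof -
  obtain a where a: "a \<in> odd_roots" "2 ^ k * a\<^sup>2 = int n"
    using assms unfolding G_pow2 by (rule rep_series_nonzeroD)
  have "a\<^sup>2 mod 8 = 1" using a(1) by (intro odd_square_mod_8 odd_rootsD)
  then have "int n mod (2 ^ k * 8) = 2 ^ k" 
    unfolding a(2)[symmetric] by (metis mult.right_neutral mult_mod_right)
  then have "int (n mod (2 ^ k * 8)) = int (2 ^ k)" by (simp add: zmod_int)
  then have "n mod (2 ^ k * 8) = 2 ^ k" by (simp only: of_nat_eq_iff)
  then show ?thesis by (simp add: power_add)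
qed

lemma fps_mult_nonzeroD:
  assumes "fps_nth (f * h :: bit fps) n \<noteq> 0"
  obtains i j where "fps_nth f i \<noteq> 0" "fps_nth h j \<noteq> 0" "n = i + j"
proof -
  have "\<exists>i\<in>{0..n}. fps_nth f i * fps_nth h (n - i) \<noteq> 0"
    using assms unfolding fps_mult_nth by (meson sum.neutral)
  then obtain i where "i \<le> n" "fps_nth f i \<noteq> 0" "fps_nth h (n - i) \<noteq> 0"
    by auto
  then show ?thesis using that[of i "n - i"] by simp
qed

lemma G5_nonzeroD:
  assumes "fps_nth G5 n \<noteq> 0"
  shows "n mod 16 = 9"
proof -
  obtain a :: int where "a mod 8 = 5" "a\<^sup>2 = int n"
    using assms unfolding G5_def by (rule rep_series_nonzeroD) simp
  then have "int n mod 16 = 9" using odd_square_mod_16_5 by metis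
  then have "int (n mod 16) = int 9" by (simp add: zmod_int)
  then show ?thesis by (simp only: of_nat_eq_iff)
qed

text \<open>The other terms of the decomposition miss the class of n: in their order, their
  exponents are 9 + 2 + 4 = 15 modulo 16, 1 + 2 = 3 modulo 8, 1 + 4 = 5 modulo 8, 1 modulo 8, and
  even.\<close>

lemma inverse_g_nth:
  assumes n: "n mod 16 = 7"
  shows "fps_nth (inverse g) n = fps_nth (G * (G\<^sup>2 * G ^ 4)) n"
proof -
  have G: "i mod 8 = 1" if "fps_nth G i \<noteq> 0" for i using G_pow2_nonzeroD[of 0] that by simp
  have G2: "i mod 16 = 2" "i mod 8 = 2" if "fps_nth (G\<^sup>2) i \<noteq> 0" for i
  proof -
    show "i mod 16 = 2" using G_pow2_nonzeroD[of 1] that by simp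
    then show "i mod 8 = 2" using mod_mod_cancel[of 8 16 i] by simp
  qed
  have G4: "i mod 16 = 4" "i mod 8 = 4" if "fps_nth (G ^ 4) i \<noteq> 0" for i
  proof -
    have "i mod 32 = 4" using G_pow2_nonzeroD[of 2] that by simp
    then show "i mod 16 = 4" "i mod 8 = 4"
      using mod_mod_cancel[of 16 32 i] mod_mod_cancel[of 8 32 i] by simp_all
  qed
  have pow: "fps_nth (f * h ^ (2 ^ k)) n = 0"
    if f: "\<And>i. fps_nth f i \<noteq> 0 \<Longrightarrow> i mod 2 ^ k \<noteq> n mod 2 ^ k" for f h :: "bit fps" and k
  proof (rule ccontr)
    assume "fps_nth (f * h ^ (2 ^ k)) n \<noteq> 0"
    then obtain i j where ij: "fps_nth f i \<noteq> 0" "n = i + 2 ^ k * j"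
      by (rule fps_mult_pow2_nonzeroD)
    then show False using f[OF ij(1)] by simp
  qed
  have n8: "n mod 8 = 7" using n mod_mod_cancel[of 8 16 n] by simp
  have "fps_nth ((G5 * (G\<^sup>2 * G ^ 4)) * inverse g ^ 16) n = 0"
  proof (rule pow[of _ 4, simplified])
    fix i assume "fps_nth (G5 * (G\<^sup>2 * G ^ 4)) i = 1"
    then have "fps_nth (G5 * (G\<^sup>2 * G ^ 4)) i \<noteq> 0" by simp
    then obtain j m where 1: "fps_nth G5 j \<noteq> 0" "fps_nth (G\<^sup>2 * G ^ 4) m \<noteq> 0" "i = j + m"
      by (rule fps_mult_nonzeroD)
    obtain k l where 2: "fps_nth (G\<^sup>2) k \<noteq> 0" "fps_nth (G ^ 4) l \<noteq> 0" "m = k + l"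
      using 1(2) by (rule fps_mult_nonzeroD)
    have "j mod 16 = 9" "k mod 16 = 2" "l mod 16 = 4"
      using G5_nonzeroD[OF 1(1)] G2[OF 2(1)] G4[OF 2(2)] by auto
    moreover have "i mod 16 = (j mod 16 + (k mod 16 + l mod 16) mod 16) mod 16"
      unfolding 1(3) 2(3) by (simp only: mod_add_left_eq mod_add_right_eq)
    ultimately have "i mod 16 = 15" by simp
    then show "i mod 16 \<noteq> n mod 16" using n by simp
  qed
  moreover have "fps_nth ((G * G\<^sup>2) * g ^ 8) n = 0"
  proof (rule pow[of _ 3, simplified])
    fix i assume "fps_nth (G * G\<^sup>2) i = 1"
    then have "fps_nth (G * G\<^sup>2) i \<noteq> 0" by simp
    then obtain j k where 1: "fps_nth G j \<noteq> 0" "fps_nth (G\<^sup>2) k \<noteq> 0" "i = j + k"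
      by (rule fps_mult_nonzeroD)
    have "j mod 8 = 1" "k mod 8 = 2" using G[OF 1(1)] G2[OF 1(2)] by auto
    then have "i mod 8 = 3" unfolding 1(3) by (simp add: mod_add_eq[symmetric])
    then show "i mod 8 \<noteq> n mod 8" using n8 by simp
  qed
  moreover have "fps_nth (G * G ^ 4) n = 0"
  proof (rule ccontr)
    assume "fps_nth (G * G ^ 4) n \<noteq> 0"
    then obtain j k where 1: "fps_nth G j \<noteq> 0" "fps_nth (G ^ 4) k \<noteq> 0" "n = j + k"
      by (rule fps_mult_nonzeroD)
    have "j mod 8 = 1" "k mod 8 = 4" using G[OF 1(1)] G4[OF 1(2)] by auto
    then have "n mod 8 = 5" unfolding 1(3) by (simp add: mod_add_eq[symmetric])
    then show False using n8 by simp
  qed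
  moreover have "fps_nth (G * g ^ 16) n = 0"
  proof (rule pow[of _ 4, simplified])
    fix i assume "fps_nth G i = 1"
    then have "i mod 8 = 1" using G by simp
    then show "i mod 16 \<noteq> n mod 16" using n8 mod_mod_cancel[of 8 16 n] mod_mod_cancel[of 8 16 i] by auto
  qed
  moreover have "fps_nth (g\<^sup>2) n = 0"
  proof -
    have "odd n" using n8 mod_mod_cancel[of 2 8 n] by (simp add: odd_iff_mod_2_eq_one)
    then show ?thesis unfolding bit_fps_square_nth by simp
  qed
  ultimately show ?thesis by (subst inverse_g_decomp) (simp only: fps_add_nth add_0_right)
qed

text \<open>As the roots are signed, every solution in positive odd integers is counted once rather
  than with all eight choices of sign.\<close>

definition ternary_reps :: "nat \<Rightarrow> (int \<times> int \<times> int) set" where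
  "ternary_reps n = {(a, b, c) \<in> odd_roots \<times> odd_roots \<times> odd_roots. a\<^sup>2 + 2 * b\<^sup>2 + 4 * c\<^sup>2 = int n}"

lemma of_nat_bit_eq: "(of_nat k :: bit) = of_bool (odd k)"
proof (induction k)
  case (Suc k)
  then show ?case by (cases "odd k") (simp_all only: of_nat_Suc, simp_all)
qed simp

lemma mem_B_iff:
  assumes "n mod 16 = 7"
  shows "n \<in> B \<longleftrightarrow> odd (card (ternary_reps n))"
proof -
  have G0: "G = rep_series odd_roots (\<lambda>_. 1) power2" by (rule odd_square_series_def)
  have G2: "G\<^sup>2 = rep_series odd_roots (\<lambda>_. 1) (\<lambda>a. 2 * a\<^sup>2)" using G_pow2[of 1] by simp
  have G4: "G ^ 4 = rep_series odd_roots (\<lambda>_. 1) (\<lambda>a. 4 * a\<^sup>2)" using G_pow2[of 2] by simp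
  have "G * (G\<^sup>2 * G ^ 4) = rep_series (odd_roots \<times> odd_roots \<times> odd_roots)
     (\<lambda>(a,p). 1 * (case p of (b,c) \<Rightarrow> 1 * 1)) (\<lambda>(a,p). a\<^sup>2 + (case p of (b,c) \<Rightarrow> 2 * b\<^sup>2 + 4 * c\<^sup>2))"
    unfolding G2 G4 unfolding G0
    by (simp only: rep_series_mult finite_sublevels_square finite_sublevels_square1
        finite_sublevels_Times zero_less_numeral)
  moreover have "{p. p \<in> odd_roots \<times> odd_roots \<times> odd_roots \<and>
      (\<lambda>(a,p). a\<^sup>2 + (case p of (b,c) \<Rightarrow> 2 * b\<^sup>2 + 4 * c\<^sup>2)) p = int n} = ternary_reps n"
    unfolding ternary_reps_def by auto
  ultimately have "fps_nth (G * (G\<^sup>2 * G ^ 4)) n = (\<Sum>p\<in>ternary_reps n. 1)"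
    by (simp add: fps_nth_rep_series case_prod_unfold)
  also have "\<dots> = of_nat (card (ternary_reps n))" by (simp only: sum_constant mult_1_right)
  also have "\<dots> = of_bool (odd (card (ternary_reps n)))" by (rule of_nat_bit_eq)
  finally show ?thesis using inverse_g_nth[OF assms] by (simp only: B_def mem_Collect_eq) simp
qed

section \<open>Sums of four odd squares\<close>

definition disc_triples :: "int \<Rightarrow> (int \<times> int \<times> int) set" where
  "disc_triples M = {(x, y, z). y > 0 \<and> z > 0 \<and> x\<^sup>2 + 4 * y * z = M}"

lemma finite_disc_triples: "finite (disc_triples M)"
proof (rule finite_subset)
  show "disc_triples M \<subseteq> {- M..M} \<times> {0..M} \<times> {0..M}"
  proof
    fix p assume "p \<in> disc_triples M"
    then obtain x y z where p: "p = (x, y, z)" and *: "y > 0" "z > 0" "x\<^sup>2 + 4 * (y * z) = M"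
      by (auto simp: disc_triples_def algebra_simps)
    have "\<bar>x\<bar> \<le> x\<^sup>2"
    proof (cases "x = 0")
      case False
      then have "\<bar>x\<bar> * 1 \<le> \<bar>x\<bar> * \<bar>x\<bar>" by (intro mult_left_mono) auto
      then show ?thesis by (simp add: power2_eq_square)
    qed simp
    moreover have "y * 1 \<le> y * z" "1 * z \<le> y * z" using * by (auto intro: mult_left_mono mult_right_mono)
    moreover have "0 \<le> x\<^sup>2" by simp
    ultimately have "- M \<le> x" "x \<le> M" "0 \<le> y" "y \<le> M" "0 \<le> z" "z \<le> M" using * by linarith+
    then show "p \<in> {- M..M} \<times> {0..M} \<times> {0..M}" by (simp add: p)
  qed
qed auto

text \<open>The triple \<open>(x, y, z)\<close> stands for the indefinite form \<open>y X\<^sup>2 + x X Y - z Y\<^sup>2\<close> of discriminant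
  \<open>M\<close>. As in Zagier's one-sentence proof, the reflection
  \<open>(x, y, z) \<mapsto> (-x - 2y, y, z - x - y)\<close> acts on the triples with \<open>z > x + y\<close>, and
  \<open>(x, y, z) \<mapsto> (-x, z, y)\<close> exchanges them with the remaining ones. The polynomial
  \<open>(x + y) (y + z) (z - x)\<close> changes sign under the first map and is invariant under the second.\<close>

lemma sum_disc_triples:
  assumes M: "M mod 8 = 5"
  shows "(\<Sum>(x, y, z)\<in>disc_triples M. y * (y * z - x\<^sup>2)) = 0"
proof -
  define S where "S = disc_triples M"
  define P where "P = {(x, y, z). (x, y, z) \<in> S \<and> z > x + y}"
  define Q where "Q = {(x, y, z). (x, y, z) \<in> S \<and> z < x + y}"
  define \<Phi> where "\<Phi> = (\<lambda>(x, y, z). (x + y) * (y + z) * (z - x) :: int)"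
  have S: "(x, y, z) \<in> S \<longleftrightarrow> y > 0 \<and> z > 0 \<and> x\<^sup>2 + 4 * y * z = M" for x y z
    by (simp add: S_def disc_triples_def)
  have finS: "finite S" unfolding S_def by (rule finite_disc_triples)
  have sub: "P \<subseteq> S" "Q \<subseteq> S" unfolding P_def Q_def by auto
  \<comment> \<open>On the boundary z = x + y the discriminant would be the square (x + 2 y)^2, and
    no square is 5 modulo 8.\<close>
  have ne: "z \<noteq> x + y" if "(x, y, z) \<in> S" for x y z
  proof
    assume z: "z = x + y"
    have eq: "M = x\<^sup>2 + 4 * y * z" using that S by simp
    have "M = (x + 2 * y)\<^sup>2" unfolding eq z by (simp add: power2_eq_square algebra_simps)
    moreover have "u\<^sup>2 mod 8 \<noteq> 5" for u :: int
    proof (cases "even u")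
      case True
      then obtain k where "u = 2 * k" by blast
      then have "even (u\<^sup>2 mod 8)" by (simp add: power2_eq_square dvd_mod)
      then show ?thesis by (metis odd_numeral)
    next
      case False
      then obtain k where "u = 2 * k + 1" by (rule oddE)
      then have "u\<^sup>2 = 4 * (k\<^sup>2 + k) + 1" by (simp add: power2_eq_square algebra_simps)
      moreover have "even (k\<^sup>2 + k)" by simp
      then obtain m where "k\<^sup>2 + k = 2 * m" by blast
      ultimately have "u\<^sup>2 = 1 + 8 * m" by simp
      then show ?thesis by simp
    qed
    ultimately show False using M by metis
  qed
  have refl: "(- x - 2 * y, y, z - x - y) \<in> P" if "(x, y, z) \<in> P" for x y z
  proof -
    have "y > 0" "z > 0" "x\<^sup>2 + 4 * y * z = M" "z > x + y"
      using that S unfolding P_def by auto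
    moreover have "(- x - 2 * y)\<^sup>2 + 4 * y * (z - x - y) = x\<^sup>2 + 4 * y * z"
      by (simp add: power2_eq_square algebra_simps)
    ultimately show ?thesis unfolding P_def using S by simp
  qed
  have "sum \<Phi> P = sum (\<lambda>p. - \<Phi> p) P"
    by (rule sum.reindex_bij_witness[where i = "\<lambda>(x,y,z). (- x - 2 * y, y, z - x - y)"
        and j = "\<lambda>(x,y,z). (- x - 2 * y, y, z - x - y)"])
      (use refl in \<open>auto simp: \<Phi>_def algebra_simps\<close>)
  then have P0: "sum \<Phi> P = 0" by (simp add: sum_negf)
  have "sum \<Phi> Q = sum \<Phi> P"
    by (rule sum.reindex_bij_witness[where i = "\<lambda>(x,y,z). (- x, z, y)" and j = "\<lambda>(x,y,z). (- x, z, y)"])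
      (auto simp: \<Phi>_def P_def Q_def S algebra_simps)
  moreover have "S = P \<union> Q" "P \<inter> Q = {}"
    unfolding P_def Q_def using ne by force+
  then have "sum \<Phi> S = sum \<Phi> P + sum \<Phi> Q"
    using finS sub by (metis sum.union_disjoint finite_subset)
  ultimately have S0: "sum \<Phi> S = 0" using P0 by simp
  \<comment> \<open>Symmetrizing in x leaves the even part (y + z) (y z - x^2) of the polynomial;
    exchanging y and z then shows that its two summands contribute equally.\<close>
  have "sum \<Phi> S = (\<Sum>(x,y,z)\<in>S. \<Phi> (- x, y, z))"
    by (rule sum.reindex_bij_witness[where i = "\<lambda>(x,y,z). (- x, y, z)" and j = "\<lambda>(x,y,z). (- x, y, z)"])
      (auto simp: S)
  then have "0 = (\<Sum>(x,y,z)\<in>S. \<Phi> (x, y, z) + \<Phi> (- x, y, z))"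
    using S0 by (simp add: sum.distrib case_prod_unfold)
  also have "\<dots> = (\<Sum>(x,y,z)\<in>S. 2 * (y * (y * z - x\<^sup>2)) + 2 * (z * (y * z - x\<^sup>2)))"
    by (rule sum.cong) (auto simp: \<Phi>_def algebra_simps power2_eq_square)
  also have "\<dots> = 2 * (\<Sum>(x,y,z)\<in>S. y * (y * z - x\<^sup>2)) + 2 * (\<Sum>(x,y,z)\<in>S. z * (y * z - x\<^sup>2))"
    by (simp add: sum.distrib case_prod_unfold sum_distrib_left)
  also have "(\<Sum>(x,y,z)\<in>S. z * (y * z - x\<^sup>2)) = (\<Sum>(x,y,z)\<in>S. y * (y * z - x\<^sup>2))"
    by (rule sum.reindex_bij_witness[where i = "\<lambda>(x,y,z). (x, z, y)" and j = "\<lambda>(x,y,z). (x, z, y)"])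
      (auto simp: S algebra_simps)
  finally show ?thesis unfolding S_def by simp
qed

section \<open>The logarithmic derivative of the theta series of odd squares\<close>

lemma euler_rep_series:
  "fps_X * fps_deriv (rep_series I w f :: int fps) = rep_series I (\<lambda>a. f a * w a) f"
proof (rule fps_ext)
  fix n
  show "fps_nth (fps_X * fps_deriv (rep_series I w f)) n = fps_nth (rep_series I (\<lambda>a. f a * w a) f) n"
    by (cases n) (simp_all add: fps_nth_rep_series sum_distrib_left del: of_nat_Suc)
qed

text \<open>An analogue of the fact that a logarithmic derivative determines a series up to a constant
  factor.\<close>

lemma log_deriv_unique:
  fixes f p q :: "int fps"
  assumes p: "f * fps_deriv p = of_nat k * fps_deriv f * p"
    and q: "f * fps_deriv q = of_nat k * fps_deriv f * q"
    and f: "fps_nth f 0 = 0" "fps_nth f 1 = 1" and eq: "fps_nth p k = fps_nth q k"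
  shows "p = q"
proof -
  define d where "d = p - q"
  have d: "f * fps_deriv d = of_nat k * (fps_deriv f * d)"
    using p q by (simp add: d_def algebra_simps)
  have "fps_nth d n = 0" for n
  proof (induction n rule: less_induct)
    case (less n)
    \<comment> \<open>Since f starts with x, all other terms involve earlier coefficients of d,
      which vanish by induction. The same holds for the right-hand side, so n d_n = k d_n; the
      equation leaves only d_k open, and \<open>eq\<close> settles it.\<close>
    have "fps_nth (f * fps_deriv d) n = int n * fps_nth d n"
    proof (cases n)
      case 0
      then show ?thesis using f by (simp add: fps_mult_nth)
    next
      case (Suc m)
      have "fps_nth (f * fps_deriv d) n = (\<Sum>i\<in>{0..n}. if i = 1 then int n * fps_nth d n else 0)"
        unfolding fps_mult_nth
      proof (rule sum.cong[OF refl])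
        fix i assume i: "i \<in> {0..n}"
        consider "i = 0" | "i = 1" | "i \<ge> 2" by linarith
        then show "fps_nth f i * fps_nth (fps_deriv d) (n - i) = (if i = 1 then int n * fps_nth d n else 0)"
        proof cases
          case 3
          then have "n - i + 1 < n" using i by auto
          then show ?thesis using less 3 by simp
        qed (use f Suc in \<open>auto simp del: of_nat_Suc\<close>)
      qed
      then show ?thesis using Suc by simp
    qed
    moreover have "fps_nth (of_nat k * (fps_deriv f * d)) n = int k * fps_nth d n"
    proof -
      have "fps_nth (fps_deriv f * d) n = (\<Sum>i\<in>{0..n}. if i = 0 then fps_nth d n else 0)"
        unfolding fps_mult_nth by (rule sum.cong) (use less f in auto)
      then show ?thesis by (simp flip: fps_of_nat)
    qed
    ultimately have "int n * fps_nth d n = int k * fps_nth d n" using d by simp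
    then show ?case using eq by (cases "n = k") (auto simp: d_def)
  qed
  then have "d = 0" by (intro fps_ext) simp
  then show ?thesis by (simp add: d_def)
qed

abbreviation (input) \<Psi> :: "int fps" where "\<Psi> \<equiv> odd_square_series"

text \<open>This is the sum of sigma(m) x^(4 m) over odd m, indexed by factorizations m = y z so
  that its product with a theta series is a sum over triples.\<close>

definition odd_sigma_series :: "int fps" where
  "odd_sigma_series = rep_series {(y, z). y > 0 \<and> z > 0 \<and> odd y \<and> odd z} (\<lambda>(y, z). y) (\<lambda>(y, z). 4 * y * z)"

lemma finite_sublevels_odd_sigma:
  "finite_sublevels {(y, z). y > 0 \<and> z > 0 \<and> odd y \<and> odd z} (\<lambda>(y, z). 4 * y * z :: int)"
proof -
  have "{p \<in> {(y, z). y > 0 \<and> z > 0 \<and> odd y \<and> odd z}. (\<lambda>(y, z). 4 * y * z) p \<le> int n}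
     \<subseteq> {0..int n} \<times> {0..int n}" for n
  proof
    fix p assume "p \<in> {p \<in> {(y, z). y > 0 \<and> z > 0 \<and> odd y \<and> odd z}. (\<lambda>(y, z). 4 * y * z) p \<le> int n}"
    then obtain y z where p: "p = (y, z)" and *: "y > 0" "z > 0" "4 * y * z \<le> int n" by auto
    have "y * 1 \<le> y * z" "1 * z \<le> y * z" using * by (auto intro: mult_left_mono mult_right_mono)
    moreover have "4 * y * z = 4 * (y * z)" by simp
    ultimately have "y \<le> int n" "z \<le> int n" using * by linarith+
    then show "p \<in> {0..int n} \<times> {0..int n}" using * by (simp add: p)
  qed
  then have "finite {p \<in> {(y, z). y > 0 \<and> z > 0 \<and> odd y \<and> odd z}. (\<lambda>(y, z). 4 * y * z) p \<le> int n}" for n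
    by (rule finite_subset) simp
  then show ?thesis unfolding finite_sublevels_def by auto
qed

text \<open>Since x d/dx multiplies the coefficient of x^n by n, the two sides differ there by 4
  times the sum of y (y z - x^2) over the triples with x = 1 modulo 4 and y, z odd. A single such
  triple forces n = 5 modulo 8. For such n all triples of discriminant n have odd entries, so by x
  -> -x the sum is half of the one in \<open>sum_disc_triples\<close>, hence 0.\<close>

lemma odd_sigma_series_euler: 
  "\<Psi> * (fps_X * fps_deriv odd_sigma_series) = 4 * ((fps_X * fps_deriv \<Psi>) * odd_sigma_series)"
proof (rule fps_ext)
  fix n
  define I where "I = {(y::int, z::int). y > 0 \<and> z > 0 \<and> odd y \<and> odd z}"
  define T where "T = {p. p \<in> odd_roots \<times> I \<and> (\<lambda>(x, p). x\<^sup>2 + (\<lambda>(y, z). 4 * y * z) p) p = int n}"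
  note fin = finite_sublevels_square1 finite_sublevels_odd_sigma[folded I_def]
  have T: "(x, y, z) \<in> T \<longleftrightarrow> x \<in> odd_roots \<and> y > 0 \<and> z > 0 \<and> odd y \<and> odd z \<and> x\<^sup>2 + 4 * y * z = int n" for x y z
    by (auto simp: T_def I_def)
  have finT: "finite T" unfolding T_def by (intro finite_sublevelsD finite_sublevels_Times fin)
  have "fps_nth (\<Psi> * (fps_X * fps_deriv odd_sigma_series)) n = (\<Sum>(x,y,z)\<in>T. 4 * y * z * y)"
    unfolding odd_sigma_series_def odd_square_series_def I_def[symmetric] euler_rep_series
      rep_series_mult[OF fin] fps_nth_rep_series T_def
    by (rule sum.cong) auto
  moreover have "fps_nth ((fps_X * fps_deriv \<Psi>) * odd_sigma_series) n = (\<Sum>(x,y,z)\<in>T. x\<^sup>2 * y)"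
    unfolding odd_sigma_series_def odd_square_series_def I_def[symmetric] euler_rep_series
      rep_series_mult[OF fin] fps_nth_rep_series T_def
    by (rule sum.cong) auto
  moreover have "fps_nth (4 * ((fps_X * fps_deriv \<Psi>) * odd_sigma_series)) n
      = 4 * fps_nth ((fps_X * fps_deriv \<Psi>) * odd_sigma_series) n"
    by (simp add: numeral_fps_const)
  moreover have "(\<Sum>(x,y,z)\<in>T. y * (y * z - x\<^sup>2)) = 0"
  proof (cases "T = {}")
    case False
    then obtain x y z where "(x, y, z) \<in> T" by auto
    then have *: "x \<in> odd_roots" "odd y" "odd z" "x\<^sup>2 + 4 * y * z = int n" using T by auto
    have "odd x" using *(1) by (rule odd_rootsD)
    then obtain k m l where "x = 2 * k + 1" "y = 2 * l + 1" "z = 2 * m + 1" using * by (elim oddE)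
    then have "int n = 4 * (k\<^sup>2 + k) + 8 * (2 * l * m + l + m) + 5"
      unfolding *(4)[symmetric] by (simp add: power2_eq_square algebra_simps)
    moreover have "even (k\<^sup>2 + k)" by simp
    then obtain j where "k\<^sup>2 + k = 2 * j" by blast
    ultimately have n: "int n = 8 * (j + (2 * l * m + l + m)) + 5" by simp
    have n8: "int n mod 8 = 5" unfolding n by (simp only: mod_mult_self4) simp
    define S where "S = disc_triples (int n)"
    define S1 where "S1 = {(x, y, z). (x, y, z) \<in> S \<and> x mod 4 = 1}"
    define S3 where "S3 = {(x, y, z). (x, y, z) \<in> S \<and> x mod 4 \<noteq> 1}"
    have par: "odd x \<and> odd y \<and> odd z" if "(x, y, z) \<in> S" for x y z
    proof -
      have eq: "x\<^sup>2 + 4 * y * z = int n" using that by (simp add: S_def disc_triples_def)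
      have "odd (int n)" unfolding n by simp
      then have "odd x" unfolding eq[symmetric] by simp
      then obtain k where "x = 2 * k + 1" by (rule oddE)
      then have "4 * (y * z) = 8 * (j + (2 * l * m + l + m)) + 4 - 4 * (k\<^sup>2 + k)"
        using eq unfolding n by (simp add: power2_eq_square algebra_simps)
      moreover have "even (k\<^sup>2 + k)" by simp
      then obtain i where "k\<^sup>2 + k = 2 * i" by blast
      ultimately have "y * z = 2 * (j + (2 * l * m + l + m) - i) + 1" by simp
      then have "odd (y * z)" by simp
      then show ?thesis using \<open>odd x\<close> by simp
    qed
    have "T = S1" unfolding S1_def using par by (auto simp: T odd_roots_def S_def disc_triples_def)
    moreover have "(\<Sum>(x,y,z)\<in>S3. y * (y * z - x\<^sup>2)) = (\<Sum>(x,y,z)\<in>S1. y * (y * z - x\<^sup>2))"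
    proof (rule sum.reindex_bij_witness[where i = "\<lambda>(x,y,z). (- x, y, z)" and j = "\<lambda>(x,y,z). (- x, y, z)"])
      have neg: "(- x) mod 4 = 1 \<longleftrightarrow> x mod 4 \<noteq> 1" if "odd x" for x :: int using that by presburger
      have memS: "(- x, y, z) \<in> S \<longleftrightarrow> (x, y, z) \<in> S" for x y z by (simp add: S_def disc_triples_def)
      show "(case p of (x,y,z) \<Rightarrow> (- x, y, z)) \<in> S1" if "p \<in> S3" for p
        using that neg par by (auto simp: S1_def S3_def memS)
      show "(case p of (x,y,z) \<Rightarrow> (- x, y, z)) \<in> S3" if "p \<in> S1" for p
        using that neg par by (auto simp: S1_def S3_def memS)
    qed auto
    moreover have "(\<Sum>(x,y,z)\<in>S. y * (y * z - x\<^sup>2)) =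
        (\<Sum>(x,y,z)\<in>S1. y * (y * z - x\<^sup>2)) + (\<Sum>(x,y,z)\<in>S3. y * (y * z - x\<^sup>2))"
    proof -
      have S: "S = S1 \<union> S3" "S1 \<inter> S3 = {}" unfolding S1_def S3_def by auto
      have "finite S" unfolding S_def by (rule finite_disc_triples)
      then show ?thesis using S by (metis (no_types, lifting) finite_Un sum.union_disjoint)
    qed
    ultimately show ?thesis using sum_disc_triples[OF n8] by (simp add: S_def)
  qed simp
  then have "(\<Sum>(x,y,z)\<in>T. 4 * y * z * y) = 4 * (\<Sum>(x,y,z)\<in>T. x\<^sup>2 * y)"
  proof -
    assume "(\<Sum>(x,y,z)\<in>T. y * (y * z - x\<^sup>2)) = 0"
    moreover have "(\<Sum>(x,y,z)\<in>T. 4 * y * z * y) - 4 * (\<Sum>(x,y,z)\<in>T. x\<^sup>2 * y) = 4 * (\<Sum>(x,y,z)\<in>T. y * (y * z - x\<^sup>2))"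
      by (simp add: sum_distrib_left case_prod_unfold algebra_simps flip: sum_subtractf)
    ultimately show ?thesis by simp
  qed
  ultimately show "fps_nth (\<Psi> * (fps_X * fps_deriv odd_sigma_series)) n = 
     fps_nth (4 * ((fps_X * fps_deriv \<Psi>) * odd_sigma_series)) n" by simp
qed

lemma odd_square_series_nth_0_1: "fps_nth \<Psi> 0 = 0" "fps_nth \<Psi> 1 = 1"
proof -
  have "{a. a \<in> odd_roots \<and> a\<^sup>2 = int 0} = {}" by (auto simp: odd_roots_def)
  then show "fps_nth \<Psi> 0 = 0" unfolding odd_square_series_def fps_nth_rep_series by simp
  have "a\<^sup>2 = 1 \<longleftrightarrow> a = 1 \<or> a = - 1" for a :: int by (rule power2_eq_1_iff)
  then have "{a. a \<in> odd_roots \<and> a\<^sup>2 = int 1} = {1}" by (auto simp: odd_roots_def)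
  then show "fps_nth \<Psi> 1 = 1" unfolding odd_square_series_def fps_nth_rep_series by simp
qed

text \<open>Both series solve the equation f p' = 4 f' p, with f the theta series, and both have
  coefficient 1 at x^4.\<close>

lemma fourth_power_eq_odd_sigma_series: "\<Psi> ^ 4 = odd_sigma_series"
proof (rule log_deriv_unique[of \<Psi> _ 4])
  have "fps_deriv (\<Psi> ^ 4) = 4 * fps_deriv \<Psi> * \<Psi> ^ 3"
    by (simp add: fps_deriv_power)
  moreover have "\<Psi> ^ 4 = \<Psi> * \<Psi> ^ 3" by (simp flip: power_Suc)
  ultimately show "\<Psi> * fps_deriv (\<Psi> ^ 4) = of_nat 4 * fps_deriv \<Psi> * \<Psi> ^ 4"
    by (simp add: mult_ac)
  have "fps_X * (\<Psi> * fps_deriv odd_sigma_series) = fps_X * (4 * (fps_deriv \<Psi> * odd_sigma_series))"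
    using odd_sigma_series_euler by (simp add: mult_ac)
  then have "\<Psi> * fps_deriv odd_sigma_series = 4 * (fps_deriv \<Psi> * odd_sigma_series)"
    by (simp only: mult_cancel_left) simp
  then show "\<Psi> * fps_deriv odd_sigma_series = of_nat 4 * fps_deriv \<Psi> * odd_sigma_series"
    by (simp add: mult_ac)
  \<comment> \<open>Splitting off x shows that the fourth power starts with x^4, without expanding a
    convolution.\<close>
  have "\<Psi> = fps_X * fps_shift 1 \<Psi>"
    by (rule fps_ext) (use odd_square_series_nth_0_1 in \<open>auto simp: fps_X_mult_nth\<close>)
  then have "\<Psi> ^ 4 = fps_X ^ 4 * fps_shift 1 \<Psi> ^ 4" by (metis power_mult_distrib)
  then have "fps_nth (\<Psi> ^ 4) 4 = fps_nth (fps_shift 1 \<Psi>) 0 ^ 4"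
    by (simp add: fps_X_power_mult_nth fps_power_zeroth)
  then have "fps_nth (\<Psi> ^ 4) 4 = 1" using odd_square_series_nth_0_1 by simp
  moreover have "{p. p \<in> {(y, z). y > 0 \<and> z > 0 \<and> odd y \<and> odd z} \<and> (\<lambda>(y, z). 4 * y * z) p = int 4}
      = {(1::int, 1::int)}"
    by (auto simp: zmult_eq_1_iff)
  then have "fps_nth odd_sigma_series 4 = 1"
    unfolding odd_sigma_series_def fps_nth_rep_series by simp
  ultimately show "fps_nth (\<Psi> ^ 4) 4 = fps_nth odd_sigma_series 4" by simp
qed (rule odd_square_series_nth_0_1)+

section \<open>From four odd squares to the form a^2 + 2 b^2 + 4 c^2 + 8 d^2\<close>

definition four_odd_squares :: "nat \<Rightarrow> ((int \<times> int) \<times> int \<times> int) set" where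
  "four_odd_squares n = {((a, b), c, d). a \<in> odd_roots \<and> b \<in> odd_roots \<and> c \<in> odd_roots \<and> d \<in> odd_roots
     \<and> a\<^sup>2 + b\<^sup>2 + (c\<^sup>2 + d\<^sup>2) = 4 * int n}"

lemma finite_four_odd_squares: "finite (four_odd_squares n)"
proof -
  have "four_odd_squares n = {p \<in> (odd_roots \<times> odd_roots) \<times> odd_roots \<times> odd_roots.
      (\<lambda>(p, q). (\<lambda>(a, b). a\<^sup>2 + b\<^sup>2) p + (\<lambda>(a, b). a\<^sup>2 + b\<^sup>2) q) p = int (4 * n)}"
    unfolding four_odd_squares_def by auto
  then show ?thesis
    by (simp only: finite_sublevelsD finite_sublevels_Times finite_sublevels_square1)
qed

text \<open>Jacobi's theorem on four odd squares. The usual factor 16 is absent because signed roots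
  fix all four signs.\<close>

lemma card_four_odd_squares:
  assumes "odd n"
  shows "card (four_odd_squares n) = (\<Sum>d | d dvd n. d)"
proof -
  define sq where "sq = (\<lambda>(a, b). a\<^sup>2 + b\<^sup>2 :: int)"
  have "\<Psi> ^ 4 = (\<Psi> * \<Psi>) * (\<Psi> * \<Psi>)" by (simp add: power4_eq_xxxx mult_ac)
  also have "\<dots> = rep_series ((odd_roots \<times> odd_roots) \<times> odd_roots \<times> odd_roots)
     (\<lambda>(p, q). (\<lambda>(a, b). 1 * 1) p * (\<lambda>(a, b). 1 * 1) q) (\<lambda>(p, q). sq p + sq q)"
    unfolding odd_square_series_def sq_def
    by (simp only: rep_series_mult finite_sublevels_Times finite_sublevels_square1)
  finally have "fps_nth (\<Psi> ^ 4) (4 * n) = (\<Sum>p\<in>four_odd_squares n. 1)"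
    by (simp only: fps_nth_rep_series) (intro sum.cong; auto simp: four_odd_squares_def sq_def)
  then have "int (card (four_odd_squares n)) = fps_nth odd_sigma_series (4 * n)"
    by (simp add: fourth_power_eq_odd_sigma_series)
  also have "\<dots> = (\<Sum>d | d dvd n. int d)"
    unfolding odd_sigma_series_def fps_nth_rep_series
  proof (rule sum.reindex_bij_witness[where i = "\<lambda>d. (int d, int (n div d))" and j = "\<lambda>(y, z). nat y"])
    fix p assume p: "p \<in> {p. p \<in> {(y, z). y > 0 \<and> z > 0 \<and> odd y \<and> odd z} \<and> (\<lambda>(y, z). 4 * y * z) p = int (4 * n)}"
    then obtain y z where p: "p = (int y, int z)" "y > 0" "z > 0" "int y * int z = int n"
      by (auto simp: algebra_simps dest!: zero_less_imp_eq_int)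
    have n: "n = y * z" using p(4) by (metis of_nat_eq_iff of_nat_mult)
    show "(int ((\<lambda>(y, z). nat y) p), int (n div (\<lambda>(y, z). nat y) p)) = p"
      "(\<lambda>(y, z). nat y) p \<in> {d. d dvd n}" "int ((\<lambda>(y, z). nat y) p) = (\<lambda>(y, z). y) p"
      using p n by auto
  next
    fix d assume "d \<in> {d. d dvd n}"
    then obtain e where n: "n = d * e" by auto
    then have "d > 0" "e > 0" "odd d" "odd e" using assms by (auto intro: Nat.gr0I)
    then show "(\<lambda>(y, z). nat y) (int d, int (n div d)) = d"
      "(int d, int (n div d)) \<in> {p. p \<in> {(y, z). y > 0 \<and> z > 0 \<and> odd y \<and> odd z} \<and> (\<lambda>(y, z). 4 * y * z) p = int (4 * n)}"
      using n by auto
  qed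
  also have "\<dots> = int (\<Sum>d | d dvd n. d)" by simp
  finally show ?thesis by (simp only: of_nat_eq_iff)
qed

definition quaternary_reps :: "nat \<Rightarrow> (int \<times> int \<times> int \<times> int) set" where
  "quaternary_reps n = {(a, b, c, d). a \<in> odd_roots \<and> b \<in> odd_roots \<and> c \<in> odd_roots \<and>
     a\<^sup>2 + 2 * b\<^sup>2 + 4 * c\<^sup>2 + 8 * d\<^sup>2 = int n}"

definition half_four_odd_squares :: "nat \<Rightarrow> ((int \<times> int) \<times> int \<times> int) set" where
  "half_four_odd_squares n = {((a, b), c, d) \<in> four_odd_squares n. (a - b) mod 8 = 4}"

lemma odd_roots_cases:
  assumes "odd a"
  obtains "a \<in> odd_roots" "- a \<notin> odd_roots" | "a \<notin> odd_roots" "- a \<in> odd_roots"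
proof -
  have "a mod 4 = 1 \<and> (- a) mod 4 \<noteq> 1 \<or> a mod 4 \<noteq> 1 \<and> (- a) mod 4 = 1" using assms by presburger
  then show ?thesis using that by (auto simp: odd_roots_def)
qed

lemma odd_rootsE:
  assumes "a \<in> odd_roots"
  obtains k where "a = 4 * k + 1"
  using assms unfolding odd_roots_def by (metis (mono_tags) mem_Collect_eq mult_div_mod_eq)

lemma odd_rootsI: "a = 4 * k + 1 \<Longrightarrow> a \<in> odd_roots"
  by (simp add: odd_roots_def)

text \<open>For r = 4 k + 1 the square r^2 is 24 k + 1 modulo 32. With a = 4 A + 1 and so on, n = 7
  modulo 8 therefore forces A + B + C + D = 1 modulo 4. Hence a + b + c + d is an odd multiple of 8,
  and exactly one of A - B and C - D is odd.\<close>

lemma four_odd_squares_split: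
  assumes n: "n mod 8 = 7" and p: "((a, b), c, d) \<in> four_odd_squares n"
  obtains e f u v where "odd e" "odd f" "odd u" "even v"
    "a - b = 4 * u \<and> c - d = 4 * v \<or> a - b = 4 * v \<and> c - d = 4 * u" "a + b - c - d = 4 * e" "a + b + c + d = 8 * f"
proof -
  have R: "a \<in> odd_roots" "b \<in> odd_roots" "c \<in> odd_roots" "d \<in> odd_roots"
    and sum: "a\<^sup>2 + b\<^sup>2 + (c\<^sup>2 + d\<^sup>2) = 4 * int n" using p by (auto simp: four_odd_squares_def)
  have sq: "\<exists>k x. r = 4 * k + 1 \<and> r\<^sup>2 = 24 * k + 32 * x + 1" if "r \<in> odd_roots" for r
  proof -
    obtain k where k: "r = 4 * k + 1" using \<open>r \<in> odd_roots\<close> by (rule odd_rootsE)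
    have "even (k * (k - 1))" by simp
    then obtain x where x: "k * (k - 1) = 2 * x" by blast
    have "r\<^sup>2 = 16 * (k * (k - 1)) + 24 * k + 1" unfolding k by (simp add: power2_eq_square algebra_simps)
    then show ?thesis using k x by auto
  qed
  obtain A x where A: "a = 4 * A + 1" "a\<^sup>2 = 24 * A + 32 * x + 1" using sq[OF R(1)] by blast
  obtain B y where B: "b = 4 * B + 1" "b\<^sup>2 = 24 * B + 32 * y + 1" using sq[OF R(2)] by blast
  obtain C z where C: "c = 4 * C + 1" "c\<^sup>2 = 24 * C + 32 * z + 1" using sq[OF R(3)] by blast
  obtain D w where D: "d = 4 * D + 1" "d\<^sup>2 = 24 * D + 32 * w + 1" using sq[OF R(4)] by blast
  have "n = 8 * (n div 8) + 7" using n mult_div_mod_eq[of 8 n] by simp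
  then obtain m where "n = 8 * m + 7" by blast
  then have s: "3 * (A + B + C + D) = 4 * (int m - x - y - z - w) + 3"
    using sum unfolding A(2) B(2) C(2) D(2) by simp
  \<comment> \<open>From 3 s = 4 r + 3 it follows that s = 4 (s - r - 1) + 1; the witness is s - r -
    1.\<close>
  define t where "t = A + B + C + D - (int m - x - y - z - w) - 1"
  have t: "A + B + C + D = 4 * t + 1" using s unfolding t_def by simp
  then have A': "A = 4 * t + 1 - B - C - D" by simp
  have e: "odd (A + B - C - D)" unfolding A' by simp
  have f: "odd (2 * t + 1)" by simp
  have sums: "a + b - c - d = 4 * (A + B - C - D)" "a + b + c + d = 8 * (2 * t + 1)"
    "a - b = 4 * (A - B)" "c - d = 4 * (C - D)"
    using t unfolding A(1) B(1) C(1) D(1) by simp_all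
  show ?thesis
  proof (cases "odd (A - B)")
    case True
    then have "even (C - D)" using e by simp
    then show ?thesis using that[OF e f True] sums by blast
  next
    case False
    then have "odd (C - D)" using e by simp
    then show ?thesis using that[OF e f _, of "C - D" "A - B"] sums False by blast
  qed
qed

text \<open>Exactly one of a - b and c - d is 4 modulo 8, the other being 0, so exchanging the two
  pairs maps the half onto its complement.\<close>

lemma card_four_odd_squares_half:
  assumes "n mod 8 = 7"
  shows "card (four_odd_squares n) = 2 * card (half_four_odd_squares n)"
proof -
  define F where "F = four_odd_squares n"
  define H where "H = half_four_odd_squares n"
  define swap where "swap = (\<lambda>(p, q). (q, p) :: (int \<times> int) \<times> int \<times> int)"
  have fin: "finite F" unfolding F_def by (rule finite_four_odd_squares)
  have swapF: "swap p \<in> F" if "p \<in> F" for p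
    using that by (auto simp: F_def four_odd_squares_def swap_def)
  have "H \<subseteq> F" by (auto simp: H_def F_def half_four_odd_squares_def)
  have one: "swap p \<in> H \<longleftrightarrow> p \<notin> H" if "p \<in> F" for p
  proof -
    obtain a b c d where p: "p = ((a, b), c, d)" by (metis surj_pair)
    have "((a, b), c, d) \<in> four_odd_squares n" using that by (simp add: p F_def)
    from four_odd_squares_split[OF assms this] obtain u v where uv: "odd u" "even v"
      "a - b = 4 * u \<and> c - d = 4 * v \<or> a - b = 4 * v \<and> c - d = 4 * u" by metis
    obtain i j where "u = 2 * i + 1" "v = 2 * j" using uv by (elim oddE evenE)
    then have "4 * u = 4 + 8 * i" "4 * v = 0 + 8 * j" by simp_all
    then have "(4 * u) mod 8 = 4" "(4 * v) mod 8 = 0" by (simp_all only: mod_mult_self2, simp_all)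
    then have "(c - d) mod 8 = 4 \<longleftrightarrow> (a - b) mod 8 \<noteq> 4" using uv(3) by auto
    then show ?thesis using that swapF[OF that]
      by (simp add: p H_def half_four_odd_squares_def F_def swap_def)
  qed
  have "bij_betw swap H (F - H)"
  proof (rule bij_betw_byWitness[where f' = swap])
    show "\<forall>p\<in>H. swap (swap p) = p" "\<forall>p\<in>F - H. swap (swap p) = p" by (auto simp: swap_def)
    show "swap ` H \<subseteq> F - H" using one swapF \<open>H \<subseteq> F\<close> by blast
    show "swap ` (F - H) \<subseteq> H" using one by blast
  qed
  then have "card (F - H) = card H" by (simp add: bij_betw_same_card)
  moreover have "card F = card H + card (F - H)"
    using fin \<open>H \<subseteq> F\<close> by (simp add: card_Diff_subset finite_subset card_mono)
  ultimately show ?thesis unfolding F_def H_def by simp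
qed

text \<open>The change of variables is e = (a + b - c - d) / 4, f = (a + b + c + d) / 8, u = (a - b)
  / 4, v = (c - d) / 8, under which a^2 + b^2 + c^2 + d^2 = 4 (e^2 + 2 u^2 + 4 f^2 + 8 v^2). These
  are integers with e, f, u odd by \<open>four_odd_squares_split\<close>. The congruence for a puts
  e into \<open>odd_roots\<close>, whereas f and u carry free signs s and t: hence the factor
  4.\<close>

lemma card_half_four_odd_squares:
  assumes n: "n mod 8 = 7"
  shows "card (half_four_odd_squares n) = 4 * card (quaternary_reps n)"
proof -
  define h :: "(int \<times> int \<times> int \<times> int) \<times> (int \<times> int) \<Rightarrow> (int \<times> int) \<times> int \<times> int"
    where "h = (\<lambda>((e, u, f, v), s, t). ((e + 2 * (s * f) + 2 * (t * u), e + 2 * (s * f) - 2 * (t * u)),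
       2 * (s * f) - e + 4 * v, 2 * (s * f) - e - 4 * v))"
  have "bij_betw h (quaternary_reps n \<times> {1, - 1} \<times> {1, - 1}) (half_four_odd_squares n)"
  proof (rule bij_betw_imageI)
    show "inj_on h (quaternary_reps n \<times> {1, - 1} \<times> {1, - 1})"
    proof (rule inj_onI)
      fix p p' assume p: "p \<in> quaternary_reps n \<times> {1, - 1} \<times> {1, - 1}"
        and p': "p' \<in> quaternary_reps n \<times> {1, - 1} \<times> {1, - 1}" and eq: "h p = h p'"
      obtain e u f v s t where 1: "p = ((e, u, f, v), s, t)" "s \<in> {1, - 1}" "t \<in> {1, - 1}"
        "u \<in> odd_roots" "f \<in> odd_roots" using p by (auto simp: quaternary_reps_def)
      obtain e' u' f' v' s' t' where 2: "p' = ((e', u', f', v'), s', t')" "s' \<in> {1, - 1}" "t' \<in> {1, - 1}"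
        "u' \<in> odd_roots" "f' \<in> odd_roots" using p' by (auto simp: quaternary_reps_def)
      have eqs: "e = e'" "v = v'" "s * f = s' * f'" "t * u = t' * u'"
        using eq unfolding 1 2 h_def by auto
      \<comment> \<open>The sign and the signed root of an odd number are determined by it, since y
        and -y are never both 1 modulo 4.\<close>
      have uniq: "x = y \<and> r = q" if "r * x = q * y" "r \<in> {1, - 1}" "q \<in> {1, - 1}" "x \<in> odd_roots" "y \<in> odd_roots"
        for r q x y :: int
      proof -
        have "- y \<notin> odd_roots" using odd_roots_cases[OF odd_rootsD[OF that(5)]] that(5) by metis
        then have "x \<noteq> - y" using that(4) by auto
        moreover have "y \<noteq> 0" using odd_rootsD[OF that(5)] by auto
        ultimately show ?thesis using that(1-3) by auto
      qed
      show "p = p'" using uniq[OF eqs(3) 1(2) 2(2) 1(5) 2(5)] uniq[OF eqs(4) 1(3) 2(3) 1(4) 2(4)] eqs 1 2 by simp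
    qed
    show "h ` (quaternary_reps n \<times> {1, - 1} \<times> {1, - 1}) = half_four_odd_squares n"
    proof (intro subset_antisym subsetI)
      fix q assume "q \<in> h ` (quaternary_reps n \<times> {1, - 1} \<times> {1, - 1})"
      then obtain e u f v s t where q: "q = h ((e, u, f, v), s, t)" and st: "s \<in> {1, - 1}" "t \<in> {1, - 1}"
        and Q: "e \<in> odd_roots" "u \<in> odd_roots" "f \<in> odd_roots"
          "e\<^sup>2 + 2 * u\<^sup>2 + 4 * f\<^sup>2 + 8 * v\<^sup>2 = int n" by (auto simp: quaternary_reps_def)
      define F where "F = s * f"
      define U where "U = t * u"
      have "F\<^sup>2 = f\<^sup>2" "U\<^sup>2 = u\<^sup>2" using st by (auto simp: F_def U_def)
      then have sum: "e\<^sup>2 + 2 * U\<^sup>2 + 4 * F\<^sup>2 + 8 * v\<^sup>2 = int n" using Q by simp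
      have "odd F" "odd U" using st odd_rootsD[OF Q(2)] odd_rootsD[OF Q(3)] by (auto simp: F_def U_def)
      then obtain i j where ij: "F = 2 * i + 1" "U = 2 * j + 1" by (elim oddE)
      obtain k where k: "e = 4 * k + 1" using Q(1) by (rule odd_rootsE)
      have q': "q = ((e + 2 * F + 2 * U, e + 2 * F - 2 * U), 2 * F - e + 4 * v, 2 * F - e - 4 * v)"
        by (simp add: q h_def F_def U_def)
      have "e + 2 * F + 2 * U \<in> odd_roots" by (rule odd_rootsI[of _ "k + i + j + 1"]) (simp add: k ij)
      moreover have "e + 2 * F - 2 * U \<in> odd_roots" by (rule odd_rootsI[of _ "k + i - j"]) (simp add: k ij)
      moreover have "2 * F - e + 4 * v \<in> odd_roots" by (rule odd_rootsI[of _ "i - k + v"]) (simp add: k ij)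
      moreover have "2 * F - e - 4 * v \<in> odd_roots" by (rule odd_rootsI[of _ "i - k - v"]) (simp add: k ij)
      moreover have "(e + 2 * F + 2 * U)\<^sup>2 + (e + 2 * F - 2 * U)\<^sup>2 + ((2 * F - e + 4 * v)\<^sup>2 + (2 * F - e - 4 * v)\<^sup>2)
          = 4 * (e\<^sup>2 + 2 * U\<^sup>2 + 4 * F\<^sup>2 + 8 * v\<^sup>2)"
        by (simp add: power2_eq_square algebra_simps)
      moreover have "(e + 2 * F + 2 * U - (e + 2 * F - 2 * U)) mod 8 = 4" unfolding ij by simp
      ultimately show "q \<in> half_four_odd_squares n"
        unfolding half_four_odd_squares_def four_odd_squares_def q' using sum by simp
    next
      fix q assume "q \<in> half_four_odd_squares n"
      then obtain a b c d where q: "q = ((a, b), c, d)" and F: "((a, b), c, d) \<in> four_odd_squares n"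
        and m: "(a - b) mod 8 = 4" by (auto simp: half_four_odd_squares_def)
      from four_odd_squares_split[OF n F] obtain e f u v where
        par: "odd e" "odd f" "odd u" "even v" and
        uv: "a - b = 4 * u \<and> c - d = 4 * v \<or> a - b = 4 * v \<and> c - d = 4 * u" 
        and ef: "a + b - c - d = 4 * e" "a + b + c + d = 8 * f" by metis
      have "(4 * v) mod 8 = 0" using par(4) by presburger
      then have "a - b = 4 * u" "c - d = 4 * v" using uv m by auto
      moreover obtain w where w: "v = 2 * w" using par(4) by blast
      ultimately have abcd: "a = e + 2 * f + 2 * u" "b = e + 2 * f - 2 * u" "c = 2 * f - e + 4 * w" "d = 2 * f - e - 4 * w"
        using ef by simp_all
      have "a \<in> odd_roots" "a\<^sup>2 + b\<^sup>2 + (c\<^sup>2 + d\<^sup>2) = 4 * int n" using F by (auto simp: four_odd_squares_def)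
      then have sum: "e\<^sup>2 + 2 * u\<^sup>2 + 4 * f\<^sup>2 + 8 * w\<^sup>2 = int n"
        unfolding abcd by (simp add: power2_eq_square algebra_simps)
      obtain k where "a = 4 * k + 1" using \<open>a \<in> odd_roots\<close> by (rule odd_rootsE)
      moreover obtain i j where "f = 2 * i + 1" "u = 2 * j + 1" using par by (elim oddE)
      ultimately have "e = 4 * (k - i - j - 1) + 1" using abcd by simp
      then have e: "e \<in> odd_roots" by (rule odd_rootsI)
      have sign: "\<exists>s y. s \<in> {1, - 1} \<and> y \<in> odd_roots \<and> x = s * y" if "odd x" for x :: int
        using odd_roots_cases[OF that] by (metis insertI1 insertI2 minus_minus mult_1 mult_minus1)
      obtain s y where s: "s \<in> {1, - 1}" "y \<in> odd_roots" "f = s * y" using sign[OF par(2)] by blast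
      obtain t z where t: "t \<in> {1, - 1}" "z \<in> odd_roots" "u = t * z" using sign[OF par(3)] by blast
      have "f\<^sup>2 = y\<^sup>2" "u\<^sup>2 = z\<^sup>2" using s t by auto
      then have Q: "(e, z, y, w) \<in> quaternary_reps n" using sum e s t by (simp add: quaternary_reps_def)
      have "(s, t) \<in> {1, - 1} \<times> {1, - 1}" using s(1) t(1) by (rule SigmaI)
      with Q have "((e, z, y, w), s, t) \<in> quaternary_reps n \<times> {1, - 1} \<times> {1, - 1}" by (rule SigmaI)
      moreover have "q = h ((e, z, y, w), s, t)" unfolding h_def q abcd s(3) t(3) by simp
      ultimately show "q \<in> h ` (quaternary_reps n \<times> {1, - 1} \<times> {1, - 1})"
        by (rule rev_image_eqI)
    qed
  qed
  then have "card (half_four_odd_squares n) = card (quaternary_reps n \<times> {1, - 1 :: int} \<times> {1, - 1 :: int})"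
    by (simp add: bij_betw_same_card)
  then show ?thesis by (simp add: card_cartesian_product)
qed

lemma finite_quaternary_reps: "finite (quaternary_reps n)"
proof -
  have "quaternary_reps n \<subseteq> {p \<in> odd_roots \<times> odd_roots \<times> odd_roots \<times> UNIV.
      (\<lambda>(a, p). a\<^sup>2 + (\<lambda>(b, p). 2 * b\<^sup>2 + (\<lambda>(c, d). 4 * c\<^sup>2 + 8 * d\<^sup>2) p) p) p = int n}"
    unfolding quaternary_reps_def by auto
  moreover have "finite {p \<in> odd_roots \<times> odd_roots \<times> odd_roots \<times> UNIV.
      (\<lambda>(a, p). a\<^sup>2 + (\<lambda>(b, p). 2 * b\<^sup>2 + (\<lambda>(c, d). 4 * c\<^sup>2 + 8 * d\<^sup>2) p) p) p = int n}"
    by (intro finite_sublevelsD finite_sublevels_Times finite_sublevels_square1 finite_sublevels_square) auto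
  ultimately show ?thesis by (rule finite_subset)
qed

text \<open>The sign change d -> -d pairs off the solutions with d nonzero; those with d = 0 are the
  ternary ones.\<close>

lemma even_card_quaternary_reps:
  "even (card (quaternary_reps n)) \<longleftrightarrow> even (card (ternary_reps n))"
proof -
  define Q where "Q = quaternary_reps n"
  define Z where "Z = {(a, b, c, d). (a, b, c, d) \<in> Q \<and> d = 0}"
  define P where "P = {(a, b, c, d). (a, b, c, d) \<in> Q \<and> d > 0}"
  define N where "N = {(a, b, c, d). (a, b, c, d) \<in> Q \<and> d < 0}"
  have fin: "finite Q" unfolding Q_def by (rule finite_quaternary_reps)
  have Q: "Q = Z \<union> P \<union> N" unfolding Z_def P_def N_def by auto
  have "card Q = card Z + card P + card N" using fin unfolding Q
    by (subst card_Un_disjoint; (subst card_Un_disjoint)?) (auto simp: Z_def P_def N_def)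
  moreover have "bij_betw (\<lambda>(a, b, c, d). (a, b, c, - d)) P N"
    by (rule bij_betw_byWitness[where f' = "\<lambda>(a, b, c, d). (a, b, c, - d)"])
      (auto simp: P_def N_def Q_def quaternary_reps_def)
  then have "card P = card N" by (rule bij_betw_same_card)
  moreover have "bij_betw (\<lambda>(a, b, c). (a, b, c, 0)) (ternary_reps n) Z"
    by (rule bij_betw_byWitness[where f' = "\<lambda>(a, b, c, d). (a, b, c)"])
      (auto simp: Z_def Q_def quaternary_reps_def ternary_reps_def)
  then have "card (ternary_reps n) = card Z" by (rule bij_betw_same_card)
  ultimately show ?thesis unfolding Q_def by auto
qed

lemma even_card_ternary_reps:
  assumes n: "n mod 8 = 7" and "16 dvd (\<Sum>d | d dvd n. d)"
  shows "even (card (ternary_reps n))"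
proof -
  have "odd n" using n mod_mod_cancel[of 2 8 n] by (simp add: odd_iff_mod_2_eq_one)
  then have "(\<Sum>d | d dvd n. d) = 8 * card (quaternary_reps n)"
    using card_four_odd_squares[of n] card_four_odd_squares_half[OF n] card_half_four_odd_squares[OF n]
    by simp
  then have "even (card (quaternary_reps n))" using assms(2) by simp
  then show ?thesis by (simp add: even_card_quaternary_reps)
qed

section \<open>Divisor sums\<close>

abbreviation (input) divisor_sum :: "nat \<Rightarrow> nat" where
  "divisor_sum n \<equiv> \<Sum>d | d dvd n. d"

lemma divisor_sum_mult_coprime:
  assumes "coprime a b" "a > 0" "b > 0"
  shows "divisor_sum (a * b) = divisor_sum a * divisor_sum b"
proof -
  have inj: "inj_on (\<lambda>(x, y). x * y) ({x. x dvd a} \<times> {y. y dvd b})"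
  proof (rule inj_onI, clarsimp)
    fix x y x' y' assume d: "x dvd a" "y dvd b" "x' dvd a" "y' dvd b" and eq: "x * y = x' * y'"
    have cop: "coprime x y'" "coprime x' y"
      using assms(1) d by (meson coprime_divisors)+
    have "x dvd x'" using cop(1) eq by (metis coprime_dvd_mult_left_iff dvd_triv_left)
    moreover have "x' dvd x" using cop(2) eq by (metis coprime_dvd_mult_left_iff dvd_triv_left)
    ultimately have "x = x'" by (rule dvd_antisym)
    moreover have "x > 0" using d(1) assms(2) by (auto intro: Nat.gr0I)
    ultimately show "x = x' \<and> y = y'" using eq by simp
  qed
  have "{d. d dvd a * b} = (\<lambda>(x, y). x * y) ` ({x. x dvd a} \<times> {y. y dvd b})"
  proof (intro subset_antisym subsetI)
    fix d assume "d \<in> {d. d dvd a * b}"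
    then obtain x y where "d = x * y" "x dvd a" "y dvd b" by (metis dvd_productE mem_Collect_eq)
    then show "d \<in> (\<lambda>(x, y). x * y) ` ({x. x dvd a} \<times> {y. y dvd b})"
      by (intro image_eqI[of _ _ "(x, y)"]) auto
  next
    fix d assume "d \<in> (\<lambda>(x, y). x * y) ` ({x. x dvd a} \<times> {y. y dvd b})"
    then show "d \<in> {d. d dvd a * b}" by (auto intro: mult_dvd_mono)
  qed
  then have "divisor_sum (a * b) = (\<Sum>(x, y)\<in>{x. x dvd a} \<times> {y. y dvd b}. x * y)"
    by (simp only: sum.reindex[OF inj] o_def)
  also have "\<dots> = divisor_sum a * divisor_sum b"
    by (simp add: sum_product sum.cartesian_product)
  finally show ?thesis .
qed

text \<open>The powers pair up: p^(2 i) + p^(2 i + 1) = p^(2 i) (p + 1).\<close>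

lemma Suc_dvd_divisor_sum_odd_power:
  assumes "prime p" "odd k"
  shows "p + 1 dvd divisor_sum (p ^ k)"
proof -
  obtain j where j: "k = 2 * j + 1" using assms(2) by (rule oddE)
  have "{d. d dvd p ^ k} = (\<lambda>i. p ^ i) ` {..k}"
    using divides_primepow_nat[OF assms(1)] by auto
  moreover have "inj_on (\<lambda>i. p ^ i) {..k}"
    using prime_gt_1_nat[OF assms(1)] by (auto intro: inj_onI)
  ultimately have "divisor_sum (p ^ k) = (\<Sum>i\<le>k. p ^ i)" by (simp add: sum.reindex)
  moreover have "p + 1 dvd (\<Sum>i\<le>2 * j + 1. p ^ i)"
  proof (induction j)
    case (Suc j)
    have "(\<Sum>i\<le>2 * Suc j + 1. p ^ i) = (\<Sum>i\<le>2 * j + 1. p ^ i) + p ^ (2 * j + 2) * (p + 1)"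
      by (simp add: algebra_simps)
    then show ?case using Suc by (metis dvd_add dvd_triv_right)
  qed simp
  ultimately show ?thesis unfolding j by simp
qed

text \<open>Peels off one prime together with its factor p + 1. Keeping the other multiplicities in
  the conclusion allows the step to be repeated.\<close>

lemma divisor_sum_split_prime:
  assumes "prime p" "odd (multiplicity p n)" "n > 0"
  obtains c m where "divisor_sum n = (p + 1) * c * divisor_sum m" "m > 0"
    "\<And>q. prime q \<Longrightarrow> q \<noteq> p \<Longrightarrow> multiplicity q m = multiplicity q n"
proof -
  define k where "k = multiplicity p n"
  obtain m where m: "n = p ^ k * m" "\<not> p dvd m"
    using multiplicity_decompose'[of n p] assms(1,3) unfolding k_def by (metis not_prime_unit not_gr_zero)
  have "m > 0" using m assms(3) by (auto intro: Nat.gr0I)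
  have "coprime (p ^ k) m" using m(2) assms(1) by (simp add: prime_imp_coprime)
  then have "divisor_sum n = divisor_sum (p ^ k) * divisor_sum m"
    unfolding m(1) using \<open>m > 0\<close> prime_gt_0_nat[OF assms(1)] by (simp add: divisor_sum_mult_coprime)
  moreover obtain c where "divisor_sum (p ^ k) = (p + 1) * c"
    using Suc_dvd_divisor_sum_odd_power[OF assms(1), of k] assms(2) unfolding k_def by blast
  moreover have "multiplicity q m = multiplicity q n" if "prime q" "q \<noteq> p" for q
  proof -
    have "multiplicity q n = multiplicity q (p ^ k) + multiplicity q m"
      unfolding m(1) using that \<open>m > 0\<close> assms(1) by (intro prime_elem_multiplicity_mult_distrib) auto
    moreover have "multiplicity q (p ^ k) = 0"
      using that assms(1) by (intro not_dvd_imp_multiplicity_0) (metis prime_dvd_power primes_dvd_imp_eq)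
    ultimately show ?thesis by simp
  qed
  ultimately show ?thesis using that \<open>m > 0\<close> by metis
qed

text \<open>Otherwise each prime power in the factorization of n would be 1 modulo 4, as p = 1
  modulo 4 or the exponent is even, and so would n.\<close>

lemma exists_prime_3_mod_4:
  assumes n: "n mod 4 = (3 :: nat)"
  shows "\<exists>p. prime p \<and> odd (multiplicity p n) \<and> p mod 4 = 3"
proof (rule ccontr)
  assume "\<nexists>p. prime p \<and> odd (multiplicity p n) \<and> p mod 4 = 3"
  then have no: "\<not> (odd (multiplicity p n) \<and> p mod 4 = 3)" if "prime p" for p using that by blast
  have "n \<noteq> 0" using n by (intro notI) simp
  have "odd n" using n mod_mod_cancel[of 2 4 n] by (simp add: odd_iff_mod_2_eq_one)
  have "[p ^ multiplicity p n = 1] (mod 4)" if "p \<in> prime_factors n" for p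
  proof -
    have p: "prime p" "p dvd n" using that by auto
    then have "odd p" using \<open>odd n\<close> by (metis dvd_trans)
    then have "p mod 4 = 1 \<or> p mod 4 = 3" by presburger
    then show ?thesis
    proof
      assume "p mod 4 = 1"
      then have "[p = 1] (mod 4)" by (simp add: unique_euclidean_semiring_class.cong_def)
      then show ?thesis using cong_pow[of p 1 4] by simp
    next
      assume "p mod 4 = 3"
      then obtain k where k: "multiplicity p n = 2 * k" using no[OF p(1)] by auto
      have "[p\<^sup>2 = 3\<^sup>2] (mod 4)" using \<open>p mod 4 = 3\<close> by (intro cong_pow) (simp add: unique_euclidean_semiring_class.cong_def)
      then have "[p\<^sup>2 = 1] (mod 4)" by (simp add: unique_euclidean_semiring_class.cong_def)
      then show ?thesis using cong_pow[of "p\<^sup>2" 1 4 k] by (simp add: k power_mult)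
    qed
  qed
  then have "[(\<Prod>p\<in>prime_factors n. p ^ multiplicity p n) = (\<Prod>p\<in>prime_factors n. 1)] (mod 4)"
    by (rule cong_prod)
  then have "[n = 1] (mod 4)" using prime_factorization_nat[of n] \<open>n \<noteq> 0\<close> by simp
  then show False using n by (simp add: unique_euclidean_semiring_class.cong_def)
qed

text \<open>A prime p = 3 modulo 4 of odd exponent supplies a factor 4 through p + 1. At least two
  further odd primes of odd exponent remain, and each supplies a factor 2.\<close>

lemma sixteen_dvd_divisor_sum:
  assumes n: "n mod 4 = (3 :: nat)" and three: "card {p \<in> prime_factors n. odd (multiplicity p n)} \<ge> 3"
  shows "16 dvd divisor_sum n"
proof -
  define P where "P = {p \<in> prime_factors n. odd (multiplicity p n)}"
  have "n > 0" using n by (intro Nat.gr0I) simp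
  have "odd n" using n mod_mod_cancel[of 2 4 n] by (simp add: odd_iff_mod_2_eq_one)
  obtain p where p: "prime p" "odd (multiplicity p n)" "p mod 4 = 3" using exists_prime_3_mod_4[OF n] by blast
  have "finite P" unfolding P_def by simp
  have "card (P - {p}) \<ge> 2" using three diff_card_le_card_Diff[of "{p}" P] unfolding P_def[symmetric] by simp
  then obtain Q where Q: "Q \<subseteq> P - {p}" "card Q = 2" by (meson obtain_subset_with_card_n)
  then obtain q r where "Q = {q, r}" "q \<noteq> r" by (meson card_2_iff)
  then have qr: "q \<in> P" "r \<in> P" "q \<noteq> p" "r \<noteq> p" "q \<noteq> r" using Q by auto
  have odd: "even (s + 1)" if "s \<in> P" for s 
    using that \<open>odd n\<close> unfolding P_def by (auto dest: dvd_trans)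
  have prime: "prime q" "prime r" using qr unfolding P_def by auto
  obtain c m where 1: "divisor_sum n = (p + 1) * c * divisor_sum m" "m > 0"
    "\<And>q. prime q \<Longrightarrow> q \<noteq> p \<Longrightarrow> multiplicity q m = multiplicity q n"
    using divisor_sum_split_prime[OF p(1,2) \<open>n > 0\<close>] by blast
  have "odd (multiplicity q m)" using 1(3)[OF prime(1) qr(3)] qr(1) by (simp add: P_def)
  then obtain c' m' where 2: "divisor_sum m = (q + 1) * c' * divisor_sum m'" "m' > 0"
    "\<And>r. prime r \<Longrightarrow> r \<noteq> q \<Longrightarrow> multiplicity r m' = multiplicity r m"
    using divisor_sum_split_prime[OF prime(1) _ 1(2)] by blast
  have "odd (multiplicity r m')" using 2(3)[OF prime(2)] 1(3)[OF prime(2)] qr by (simp add: P_def)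
  then obtain c'' m'' where 3: "divisor_sum m' = (r + 1) * c'' * divisor_sum m''"
    using divisor_sum_split_prime[OF prime(2) _ 2(2)] by blast
  have "4 dvd p + 1" using p(3) by presburger
  moreover have "2 dvd q + 1" "2 dvd r + 1" using odd qr by auto
  ultimately have "4 * (2 * 2) dvd (p + 1) * ((q + 1) * (r + 1))" by (intro mult_dvd_mono)
  then have "16 dvd (p + 1) * ((q + 1) * (r + 1))" by (simp only: numeral_times_numeral semiring_norm)
  moreover have "divisor_sum n = (p + 1) * ((q + 1) * (r + 1)) * (c * c' * c'' * divisor_sum m'')"
    unfolding 1(1) 2(1) 3 by (simp only: mult_ac)
  ultimately show ?thesis by (simp only: dvd_mult2)
qed

section \<open>Squares times one or two primes\<close>

lemma prod_primes_dvd: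
  assumes "finite S" "\<And>p. p \<in> S \<Longrightarrow> prime p \<and> p dvd (n :: nat)"
  shows "\<Prod>S dvd n"
  using assms
proof (induction S)
  case (insert p S)
  have "coprime p (\<Prod>S)"
  proof (rule prod_coprime_right)
    fix q assume "q \<in> S"
    then show "coprime p q" using insert by (metis insertCI primes_coprime)
  qed
  then show ?case using insert by (simp add: divides_mult)
qed simp

text \<open>With N = 2^k, every prime between N and 2 N divides the central binomial coefficient,
  which is at most 2^(2 N). If there are c of them, N^c <= 2^(2 N), and the exponents of 2 are
  compared.\<close>

lemma card_primes_dyadic:
  "k * card {p :: nat. prime p \<and> 2 ^ k < p \<and> p \<le> 2 ^ (k + 1)} \<le> 2 ^ (k + 1)"
proof -
  define N :: nat where "N = 2 ^ k"
  define S where "S = {p. prime p \<and> N < p \<and> p \<le> 2 * N}"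
  have fin: "finite S" by (rule finite_subset[of _ "{..2 * N}"]) (auto simp: S_def)
  have "\<Prod>S dvd (2 * N) choose N"
  proof (rule prod_primes_dvd[OF fin])
    fix p assume p: "p \<in> S"
    have "p dvd fact (2 * N)" using p by (simp add: S_def prime_dvd_fact_iff)
    also have "fact (2 * N) = fact N * fact N * (2 * N choose N)"
      using binomial_fact_lemma[of N "2 * N"] by simp
    finally have "p dvd fact N * fact N * (2 * N choose N)" .
    moreover have "\<not> p dvd fact N" using p by (simp add: S_def prime_dvd_fact_iff)
    ultimately show "prime p \<and> p dvd (2 * N choose N)" using p by (auto simp: S_def prime_dvd_mult_iff)
  qed
  then have "\<Prod>S \<le> (2 * N) choose N" by (rule dvd_imp_le) simp
  also have "\<dots> \<le> 2 ^ (2 * N)" by (rule binomial_le_pow2)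
  finally have "\<Prod>S \<le> 2 ^ (2 * N)" .
  moreover have "(\<Prod>p\<in>S. N) \<le> \<Prod>S" by (rule prod_mono) (auto simp: S_def)
  ultimately have "2 ^ (k * card S) \<le> (2 :: nat) ^ (2 * N)" by (simp add: N_def power_mult)
  then have "k * card S \<le> 2 * N" by (rule power_le_imp_le_exp[rotated]) simp
  then show ?thesis unfolding S_def N_def by simp
qed

lemma primes_pow2_Suc:
  "{p :: nat. prime p \<and> p \<le> 2 ^ (k + 1)} = {p. prime p \<and> p \<le> 2 ^ k} \<union> {p. prime p \<and> 2 ^ k < p \<and> p \<le> 2 ^ (k + 1)}"
  (is "?A = ?B \<union> ?C") and finite_primes_le: "finite {p :: nat. prime p \<and> p \<le> n}"
proof -
  have "(2::nat) ^ k \<le> 2 ^ (k + 1)" by simp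
  then show "?A = ?B \<union> ?C" by (auto intro: order_trans)
  show "finite {p :: nat. prime p \<and> p \<le> n}" by (rule finite_subset[of _ "{..n}"]) auto
qed

text \<open>With a constant C in place of 6 the induction step needs C + 2 <= 2 C k / (k + 1), which
  at k = 2 means C >= 6. For k = 1 this inequality fails, so that step counts all numbers up to 4
  instead.\<close>

lemma card_primes_le_pow2:
  assumes "k \<ge> 1"
  shows "real (card {p :: nat. prime p \<and> p \<le> 2 ^ k}) \<le> 6 * 2 ^ k / k"
  using assms
proof (induction k rule: nat_induct_at_least)
  case base
  have "{p :: nat. prime p \<and> p \<le> 2 ^ 1} \<subseteq> {2}" by (auto dest: prime_ge_2_nat)
  then have "card {p :: nat. prime p \<and> p \<le> 2 ^ 1} \<le> 1" using card_mono[of "{2::nat}"] by force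
  then show ?case by simp
next
  case (Suc k)
  define P where "P = {p :: nat. prime p \<and> p \<le> 2 ^ k}"
  define D where "D = {p :: nat. prime p \<and> 2 ^ k < p \<and> p \<le> 2 ^ (k + 1)}"
  have "real (k * card D) \<le> real (2 ^ (k + 1))"
    using card_primes_dyadic[of k] unfolding D_def[symmetric] by (simp only: of_nat_le_iff)
  then have "real (card D) \<le> 2 * 2 ^ k / k" using Suc(1) by (simp add: field_simps)
  moreover have "real (card {p :: nat. prime p \<and> p \<le> 2 ^ Suc k}) \<le> real (card P) + real (card D)"
    using card_Un_le[of P D] primes_pow2_Suc[of k] unfolding P_def D_def by simp
  moreover have "real (card P) \<le> 6 * 2 ^ k / k" using Suc unfolding P_def by simp
  ultimately have *: "real (card {p :: nat. prime p \<and> p \<le> 2 ^ Suc k}) \<le> 8 * 2 ^ k / k"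
    by (simp add: add_divide_distrib[symmetric])
  show ?case
  proof (cases "k = 1")
    case True
    have "{p :: nat. prime p \<and> p \<le> 2 ^ Suc k} \<subseteq> {..4}" unfolding True by auto
    then have "card {p :: nat. prime p \<and> p \<le> 2 ^ Suc k} \<le> card {..4 :: nat}" by (intro card_mono) auto
    then show ?thesis unfolding True by simp
  next
    case False
    then have "k \<ge> 2" using Suc by simp
    then have "8 * 2 ^ k / k \<le> 6 * 2 ^ Suc k / real (Suc k)"
      by (simp add: divide_simps)
    then show ?thesis using * by simp
  qed
qed

lemma harmonic_le_ln: "n \<ge> 1 \<Longrightarrow> (\<Sum>k=1..n. 1 / real k) \<le> 1 + ln (real n)"
proof (induction n rule: nat_induct_at_least)
  case (Suc n)
  have "ln (real n / real (Suc n)) \<le> real n / real (Suc n) - 1"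
    using Suc(1) by (intro ln_le_minus_one) simp
  also have "\<dots> = - (1 / real (Suc n))" by (simp add: field_simps)
  finally have "ln (real n) - ln (real (Suc n)) \<le> - (1 / real (Suc n))"
    using Suc(1) by (simp add: ln_div)
  then show ?case using Suc by simp
qed simp

text \<open>The primes between 2^j and 2^(j + 1) number at most 2^(j + 1) / j and each exceeds 2^j,
  so the block contributes at most 2 / j. The initial 1 covers the prime 2.\<close>

lemma sum_inverse_primes_le_pow2:
  "(\<Sum>p | prime p \<and> p \<le> 2 ^ (k + 1). 1 / real p) \<le> 1 + 2 * (\<Sum>j=1..k. 1 / real j)"
proof (induction k)
  case 0
  have "{p :: nat. prime p \<and> p \<le> 2 ^ (0 + 1)} \<subseteq> {2}" by (auto dest: prime_ge_2_nat)
  then have "(\<Sum>p | prime p \<and> p \<le> 2 ^ (0 + 1). 1 / real p) \<le> (\<Sum>p\<in>{2::nat}. 1 / real p)"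
    by (intro sum_mono2) auto
  then show ?case by simp
next
  case (Suc k)
  define P where "P = {p :: nat. prime p \<and> p \<le> 2 ^ (k + 1)}"
  define D where "D = {p :: nat. prime p \<and> 2 ^ (k + 1) < p \<and> p \<le> 2 ^ (k + 1 + 1)}"
  have "finite D" unfolding D_def by (rule finite_subset[OF _ finite_primes_le[of "2 ^ (k + 1 + 1)"]]) auto
  have "(\<Sum>p\<in>D. 1 / real p) \<le> (\<Sum>p\<in>D. 1 / 2 ^ (k + 1))"
  proof (rule sum_mono)
    fix p assume "p \<in> D"
    then have "real (2 ^ (k + 1)) \<le> real p" unfolding D_def by (simp only: of_nat_le_iff) simp
    then have "2 ^ (k + 1) \<le> real p" by simp
    then show "1 / real p \<le> 1 / 2 ^ (k + 1)" by (intro frac_le) auto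
  qed
  also have "\<dots> = real (card D) / 2 ^ (k + 1)" by simp
  also have "\<dots> \<le> 2 / real (k + 1)"
  proof -
    have "real ((k + 1) * card D) \<le> real (2 ^ (k + 1 + 1))"
      using card_primes_dyadic[of "k + 1"] unfolding D_def[symmetric] by (simp only: of_nat_le_iff)
    then show ?thesis by (simp add: field_simps)
  qed
  finally have D: "(\<Sum>p\<in>D. 1 / real p) \<le> 2 / real (k + 1)" .
  have "(\<Sum>p | prime p \<and> p \<le> 2 ^ (Suc k + 1). 1 / real p) = (\<Sum>p\<in>P \<union> D. 1 / real p)"
    using primes_pow2_Suc[of "k + 1"] unfolding P_def D_def by simp
  also have "\<dots> = (\<Sum>p\<in>P. 1 / real p) + (\<Sum>p\<in>D. 1 / real p)"
    using \<open>finite D\<close> finite_primes_le by (intro sum.union_disjoint) (auto simp: P_def D_def)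
  also have "\<dots> \<le> 1 + 2 * (\<Sum>j=1..k. 1 / real j) + 2 / real (k + 1)"
    using Suc D unfolding P_def by simp
  finally show ?case by simp
qed

lemma pow2_bracket:
  assumes "x \<ge> (2 :: real)"
  obtains k :: nat where "k \<ge> 1" "2 ^ k \<le> x" "x < 2 ^ (k + 1)"
proof -
  define n where "n = nat \<lfloor>x\<rfloor>"
  have n: "n \<ge> 2" "real n \<le> x" "x < real (n + 1)" using assms unfolding n_def by linarith+
  obtain k where k: "2 ^ k \<le> n" "n < 2 ^ (k + 1)" using ex_power_ivl1[of 2 n] n by auto
  have "k \<noteq> 0" using k n by (intro notI) simp
  moreover have "real (2 ^ k) \<le> real n" "real (n + 1) \<le> real (2 ^ (k + 1))" using k by linarith+
  then have "real (2 ^ k) \<le> x" "x < real (2 ^ (k + 1))" using n by linarith+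
  then have "2 ^ k \<le> x" "x < 2 ^ (k + 1)" by simp_all
  ultimately show ?thesis using that[of k] by simp
qed

lemma card_primes_le:
  assumes "x \<ge> 2"
  shows "real (card {p :: nat. prime p \<and> real p \<le> x}) \<le> 12 * x / ln x"
proof -
  obtain k :: nat where k: "k \<ge> 1" "2 ^ k \<le> x" "x < 2 ^ (k + 1)" using assms by (rule pow2_bracket)
  have "{p :: nat. prime p \<and> real p \<le> x} \<subseteq> {p. prime p \<and> p \<le> 2 ^ (k + 1)}"
  proof clarify
    fix p :: nat assume "real p \<le> x"
    then have "real p < real (2 ^ (k + 1))" using k by simp
    then show "p \<le> 2 ^ (k + 1)" by (simp only: of_nat_less_iff)
  qed
  then have "real (card {p :: nat. prime p \<and> real p \<le> x}) \<le> real (card {p :: nat. prime p \<and> p \<le> 2 ^ (k + 1)})"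
    using card_mono[OF finite_primes_le] by (simp only: of_nat_le_iff)
  also have "\<dots> \<le> 6 * 2 ^ (k + 1) / real (k + 1)" using card_primes_le_pow2[of "k + 1"] by simp
  \<comment> \<open>Rounding x up to a power of 2 at most doubles it, which turns 6 into 12.\<close>
  also have "\<dots> \<le> 12 * x / real (k + 1)" using k by (intro divide_right_mono) auto
  also have "\<dots> \<le> 12 * x / ln x"
  proof (rule divide_left_mono)
    have "ln x \<le> ln (2 ^ (k + 1))" using k assms by simp
    also have "\<dots> = real (k + 1) * ln 2" by (rule ln_realpow)
    also have "\<dots> \<le> real (k + 1) * 1" using ln_2_less_1 by (intro mult_left_mono) auto
    finally show "ln x \<le> real (k + 1)" by simp
  qed (use assms in auto)
  finally show ?thesis .
qed

lemma sum_inverse_primes_le: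
  assumes "x \<ge> 2"
  shows "(\<Sum>p | prime p \<and> real p \<le> x. 1 / real p) \<le> 3 + 2 * ln (ln x / ln 2)"
proof -
  obtain k :: nat where k: "k \<ge> 1" "2 ^ k \<le> x" "x < 2 ^ (k + 1)" using assms by (rule pow2_bracket)
  have "{p :: nat. prime p \<and> real p \<le> x} \<subseteq> {p. prime p \<and> p \<le> 2 ^ (k + 1)}"
  proof clarify
    fix p :: nat assume "real p \<le> x"
    then have "real p < real (2 ^ (k + 1))" using k by simp
    then show "p \<le> 2 ^ (k + 1)" by (simp only: of_nat_less_iff)
  qed
  then have "(\<Sum>p | prime p \<and> real p \<le> x. 1 / real p) \<le> (\<Sum>p | prime p \<and> p \<le> 2 ^ (k + 1). 1 / real p)"
    by (intro sum_mono2 finite_primes_le) auto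
  also have "\<dots> \<le> 1 + 2 * (\<Sum>j=1..k. 1 / real j)" by (rule sum_inverse_primes_le_pow2)
  also have "\<dots> \<le> 1 + 2 * (1 + ln (real k))" using harmonic_le_ln[OF k(1)] by simp
  also have "\<dots> \<le> 1 + 2 * (1 + ln (ln x / ln 2))"
  proof -
    have "real k * ln 2 = ln (2 ^ k)" by (simp add: ln_realpow)
    also have "\<dots> \<le> ln x" using k assms by simp
    finally have "real k \<le> ln x / ln 2" by (simp add: field_simps)
    then show ?thesis using k(1) by simp
  qed
  finally show ?thesis by simp
qed

section \<open>Counting squares times one or two primes\<close>

lemma sum_inverse_squares_tail:
  assumes "M \<ge> (1 :: nat)"
  shows "(\<Sum>m\<in>{M<..M + j}. 1 / (real m)\<^sup>2) \<le> 1 / real M - 1 / real (M + j)"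
proof (induction j)
  case (Suc j)
  have "{M<..M + Suc j} = insert (M + Suc j) {M<..M + j}" by auto
  then have "(\<Sum>m\<in>{M<..M + Suc j}. 1 / (real m)\<^sup>2) = 1 / (real (M + Suc j))\<^sup>2 + (\<Sum>m\<in>{M<..M + j}. 1 / (real m)\<^sup>2)"
    by simp
  also have "\<dots> \<le> 1 / (real (M + Suc j))\<^sup>2 + (1 / real M - 1 / real (M + j))" using Suc by simp
  also have "\<dots> \<le> 1 / real M - 1 / real (M + Suc j)"
  proof -
    define a where "a = real (M + j)"
    have a: "a > 0" "real (M + Suc j) = a + 1" using assms by (auto simp: a_def)
    have "1 / (a + 1)\<^sup>2 \<le> 1 / a - 1 / (a + 1)"
      using a(1) by (simp add: divide_simps power2_eq_square)
    then show ?thesis unfolding a(2) a_def by simp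
  qed
  finally show ?case .
qed simp

text \<open>The value p = 1 encodes the case of a single prime. The ordering p < q yields p^2 <= n,
  which is what keeps p below y^(1/2) in the count.\<close>

definition almost_square :: "nat set" where
  "almost_square = {n. \<exists>m p q. n = m\<^sup>2 * p * q \<and> m \<ge> 1 \<and> (p = 1 \<or> prime p) \<and> prime q \<and> p < q}"

lemma card_multiples_of_large_squares:
  assumes "M \<ge> (1 :: nat)" "y \<ge> 1"
  shows "finite {n. \<exists>m>M. \<exists>k\<ge>1. n = m\<^sup>2 * k \<and> real n \<le> y}"
    and "real (card {n. \<exists>m>M. \<exists>k\<ge>1. n = m\<^sup>2 * k \<and> real n \<le> y}) \<le> y / M"
proof -
  define S where "S = {n. \<exists>m>M. \<exists>k\<ge>1. n = m\<^sup>2 * k \<and> real n \<le> y}"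
  define N where "N = nat \<lfloor>y\<rfloor>"
  define T where "T m = (\<lambda>k. m\<^sup>2 * k) ` {1..nat \<lfloor>y / (real m)\<^sup>2\<rfloor>}" for m :: nat
  have sub: "S \<subseteq> (\<Union>m\<in>{M<..M + N}. T m)"
  proof
    fix n assume "n \<in> S"
    then obtain m k where n: "m > M" "k \<ge> 1" "n = m\<^sup>2 * k" "real n \<le> y" by (auto simp: S_def)
    have "m * 1 \<le> m * (m * k)" using n by (intro mult_left_mono) auto
    then have "m \<le> n" using n(3) by (simp add: power2_eq_square mult.assoc)
    then have "m \<le> N" using n(4) unfolding N_def by linarith
    moreover have "real k \<le> y / (real m)\<^sup>2" using n by (simp add: field_simps)
    then have "k \<le> nat \<lfloor>y / (real m)\<^sup>2\<rfloor>" by linarith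
    then have "n \<in> T m" unfolding T_def n(3) using n(2) by auto
    ultimately show "n \<in> (\<Union>m\<in>{M<..M + N}. T m)" using n(1) by auto
  qed
  have fin: "finite (\<Union>m\<in>{M<..M + N}. T m)" by (auto simp: T_def)
  show "finite {n. \<exists>m>M. \<exists>k\<ge>1. n = m\<^sup>2 * k \<and> real n \<le> y}"
    using finite_subset[OF sub fin] unfolding S_def .
  have "card S \<le> card (\<Union>m\<in>{M<..M + N}. T m)" using sub fin by (rule card_mono[rotated])
  also have "\<dots> \<le> (\<Sum>m\<in>{M<..M + N}. card (T m))" by (rule card_UN_le) simp
  finally have "real (card S) \<le> (\<Sum>m\<in>{M<..M + N}. real (card (T m)))"
    by (simp flip: of_nat_sum)
  also have "\<dots> \<le> (\<Sum>m\<in>{M<..M + N}. y * (1 / (real m)\<^sup>2))"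
  proof (rule sum_mono)
    fix m
    have "card (T m) \<le> nat \<lfloor>y / (real m)\<^sup>2\<rfloor>" unfolding T_def by (rule order_trans[OF card_image_le]) auto
    moreover have "real (nat \<lfloor>y / (real m)\<^sup>2\<rfloor>) \<le> y / (real m)\<^sup>2" using assms by (intro of_nat_floor) simp
    ultimately show "real (card (T m)) \<le> y * (1 / (real m)\<^sup>2)" by simp
  qed
  also have "\<dots> \<le> y * (1 / M)"
    unfolding sum_distrib_left[symmetric]
  proof (rule mult_left_mono)
    show "(\<Sum>m\<in>{M<..M + N}. 1 / (real m)\<^sup>2) \<le> 1 / M"
      by (rule order_trans[OF sum_inverse_squares_tail[OF assms(1)]]) simp
  qed (use assms in simp)
  finally show "real (card {n. \<exists>m>M. \<exists>k\<ge>1. n = m\<^sup>2 * k \<and> real n \<le> y}) \<le> y / M"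
    unfolding S_def by simp
qed

text \<open>For fixed m and p, Chebyshev's bound is applied to q <= X = y / (m^2 p). From m <=
  y^(1/8) and p <= y^(1/2) one gets X >= y^(1/4), hence ln X >= ln y / 4, and y >= 16 ensures X >=
  2. This bound is uniform, so the double sum factors. The constant is 96 = 12 * 4 * 2, where 2
  bounds the sum of 1 / m^2; in the last factor 4 = 1 + 3, with 1 for p = 1.\<close>

lemma card_almost_square_small_square:
  assumes "y \<ge> 16" "real M \<le> y powr (1 / 8)" "M \<ge> 1"
  defines "A \<equiv> {n. \<exists>m p q. n = m\<^sup>2 * p * q \<and> 1 \<le> m \<and> m \<le> M \<and> (p = 1 \<or> prime p) \<and> prime q \<and> p < q \<and> real n \<le> y}"
  shows "finite A" "real (card A) \<le> 96 * y / ln y * (4 + 2 * ln (ln y / ln 2))"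
proof -
  define P where "P = {p :: nat. (p = 1 \<or> prime p) \<and> (real p)\<^sup>2 \<le> y}"
  define X where "X m p = y / ((real m)\<^sup>2 * real p)" for m p :: nat
  define T where "T m p = (\<lambda>q. m\<^sup>2 * p * q) ` {q. prime q \<and> real q \<le> X m p}" for m p :: nat
  have P_le: "real p \<le> y" if "(real p)\<^sup>2 \<le> y" for p :: nat
  proof -
    have "p \<le> p\<^sup>2" by (simp add: power2_eq_square)
    then have "real p \<le> real (p\<^sup>2)" by (simp only: of_nat_le_iff)
    also have "\<dots> \<le> y" using that by simp
    finally show ?thesis .
  qed
  have P_sub: "P \<subseteq> insert 1 {p. prime p \<and> real p \<le> y}" using P_le by (auto simp: P_def)
  have fin_primes: "finite {p :: nat. prime p \<and> real p \<le> x}" for x :: real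
    by (rule finite_subset[of _ "{..nat \<lfloor>x\<rfloor>}"]) (auto, linarith)
  have finP: "finite P" using P_sub fin_primes by (meson finite_insert finite_subset)
  have sub: "A \<subseteq> (\<Union>m\<in>{1..M}. \<Union>p\<in>P. T m p)"
  proof
    fix n assume "n \<in> A"
    then obtain m p q where n: "n = m\<^sup>2 * p * q" "1 \<le> m" "m \<le> M" "p = 1 \<or> prime p" "prime q" "p < q" "real n \<le> y"
      unfolding A_def by blast
    have p: "p > 0" using n(4) by (auto dest: prime_gt_0_nat)
    have "1 * (p * p) \<le> m\<^sup>2 * (p * q)" using n by (intro mult_mono) auto
    then have "real (p * p) \<le> real n" unfolding n(1) by (simp only: of_nat_le_iff mult.assoc mult_1)
    then have "(real p)\<^sup>2 \<le> y" using n(7) by (simp add: power2_eq_square)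
    then have "p \<in> P" using n(4) by (simp add: P_def)
    moreover have "real q \<le> X m p" using n p unfolding X_def by (simp add: field_simps)
    then have "n \<in> T m p" unfolding T_def n(1) using n(5) by (intro imageI) simp
    moreover have "m \<in> {1..M}" using n by simp
    ultimately show "n \<in> (\<Union>m\<in>{1..M}. \<Union>p\<in>P. T m p)" by blast
  qed
  have fin: "finite (\<Union>m\<in>{1..M}. \<Union>p\<in>P. T m p)" using finP fin_primes by (auto simp: T_def)
  show "finite A" using sub fin by (rule finite_subset)
  have lny: "ln y > 0" using assms by simp
  have T: "real (card (T m p)) \<le> 48 * y / ln y * (1 / (real m)\<^sup>2 * (1 / real p))" if "m \<in> {1..M}" "p \<in> P" for m p
  proof -
    have p: "p > 0" "(real p)\<^sup>2 \<le> y" using that by (auto simp: P_def dest: prime_gt_0_nat)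
    have "real p \<le> y powr (1 / 2)" using p by (metis powr_half_sqrt real_le_rsqrt assms(1) order_trans zero_le_numeral)
    moreover have "(real m)\<^sup>2 \<le> y powr (1 / 4)"
    proof -
      have "real m \<le> y powr (1 / 8)" using that assms by auto
      then have "(real m)\<^sup>2 \<le> (y powr (1 / 8))\<^sup>2" by (intro power_mono) auto
      then show ?thesis by (simp add: power2_eq_square flip: powr_add)
    qed
    ultimately have "(real m)\<^sup>2 * real p \<le> y powr (1 / 4) * y powr (1 / 2)" by (intro mult_mono) auto
    also have "\<dots> = y powr (3 / 4)" by (simp flip: powr_add)
    finally have mp: "(real m)\<^sup>2 * real p \<le> y powr (3 / 4)" .
    have pos: "(real m)\<^sup>2 * real p > 0" using that p by simp
    have "y powr (1 / 4) * y powr (3 / 4) = y" using assms(1) by (simp flip: powr_add)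
    then have "y powr (1 / 4) = y / y powr (3 / 4)" using assms(1) by (simp add: field_simps)
    also have "\<dots> \<le> X m p" unfolding X_def using mp pos assms by (intro divide_left_mono) auto
    finally have X: "y powr (1 / 4) \<le> X m p" .
    have "2 = (16 :: real) powr (1 / 4)"
      using powr_powr[of 2 4 "1 / 4"] by simp
    also have "\<dots> \<le> y powr (1 / 4)" using assms by (intro powr_mono2) auto
    finally have X2: "X m p \<ge> 2" using X by simp
    have "ln y / 4 = ln (y powr (1 / 4))" using assms by (simp add: ln_powr)
    also have "\<dots> \<le> ln (X m p)" using X assms(1) by (intro ln_mono) auto
    finally have lnX: "ln y / 4 \<le> ln (X m p)" .
    have "real (card (T m p)) \<le> real (card {q :: nat. prime q \<and> real q \<le> X m p})"
      unfolding T_def using card_image_le[OF fin_primes] by simp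
    also have "\<dots> \<le> 12 * X m p / ln (X m p)" using X2 by (rule card_primes_le)
    also have "\<dots> \<le> 12 * X m p / (ln y / 4)" using lnX lny X2 by (intro divide_left_mono) auto
    also have "\<dots> = 48 * y / ln y * (1 / (real m)\<^sup>2 * (1 / real p))" by (simp add: X_def)
    finally show ?thesis .
  qed
  have m_sum: "(\<Sum>m\<in>{1..M}. 1 / (real m)\<^sup>2) \<le> 2"
  proof -
    have "{1..M} = insert 1 {1<..1 + (M - 1)}" using assms by auto
    then have "(\<Sum>m\<in>{1..M}. 1 / (real m)\<^sup>2) = 1 + (\<Sum>m\<in>{1<..1 + (M - 1)}. 1 / (real m)\<^sup>2)" by simp
    also have "\<dots> \<le> 1 + (1 / real 1 - 1 / real (1 + (M - 1)))"
      using sum_inverse_squares_tail[of 1 "M - 1"] by simp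
    also have "\<dots> \<le> 2" by simp
    finally show ?thesis .
  qed
  have p_sum: "(\<Sum>p\<in>P. 1 / real p) \<le> 4 + 2 * ln (ln y / ln 2)"
  proof -
    have "(\<Sum>p\<in>P. 1 / real p) \<le> (\<Sum>p\<in>insert 1 {p. prime p \<and> real p \<le> y}. 1 / real p)"
      using P_sub fin_primes by (intro sum_mono2) auto
    also have "\<dots> = 1 + (\<Sum>p | prime p \<and> real p \<le> y. 1 / real p)"
      using fin_primes by (subst sum.insert) auto
    also have "\<dots> \<le> 1 + (3 + 2 * ln (ln y / ln 2))"
      using sum_inverse_primes_le[of y] assms(1) by simp
    finally show ?thesis by simp
  qed
  have "card A \<le> card (\<Union>m\<in>{1..M}. \<Union>p\<in>P. T m p)" using fin sub by (rule card_mono)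
  also have "\<dots> \<le> (\<Sum>m\<in>{1..M}. card (\<Union>p\<in>P. T m p))" by (rule card_UN_le) simp
  also have "\<dots> \<le> (\<Sum>m\<in>{1..M}. \<Sum>p\<in>P. card (T m p))" using finP by (intro sum_mono card_UN_le)
  finally have "real (card A) \<le> (\<Sum>m\<in>{1..M}. \<Sum>p\<in>P. real (card (T m p)))"
    by (simp flip: of_nat_sum)
  also have "\<dots> \<le> (\<Sum>m\<in>{1..M}. \<Sum>p\<in>P. 48 * y / ln y * (1 / (real m)\<^sup>2 * (1 / real p)))"
    using T by (intro sum_mono) auto
  also have "\<dots> = 48 * y / ln y * ((\<Sum>m\<in>{1..M}. 1 / (real m)\<^sup>2) * (\<Sum>p\<in>P. 1 / real p))"
    unfolding sum_product by (simp add: sum_distrib_left)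
  also have "\<dots> \<le> 48 * y / ln y * (2 * (4 + 2 * ln (ln y / ln 2)))"
    using m_sum p_sum lny assms(1) by (intro mult_left_mono mult_mono) (auto intro: sum_nonneg)
  also have "48 * y / ln y * (2 * z) = 96 * y / ln y * z" for z by simp
  finally show "real (card A) \<le> 96 * y / ln y * (4 + 2 * ln (ln y / ln 2))" .
qed

lemma card_almost_square_bigo:
  "(\<lambda>y. real (card {n \<in> almost_square. real n \<le> y})) \<in> O[at_top](\<lambda>y. y * ln (ln y) / ln y)"
proof -
  \<comment> \<open>The second summand bounds the contribution of m > y^(1/8); it has order y^(7/8)
    and is negligible.\<close>
  define F where "F y = 96 * y / ln y * (4 + 2 * ln (ln y / ln 2)) + y / (y powr (1 / 8) - 1)" for y :: real
  \<comment> \<open>As 256 = 2^8, the eighth root of y is at least 2, so M >= 1 and the denominators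
    are positive.\<close>
  have "real (card {n \<in> almost_square. real n \<le> y}) \<le> F y" if y: "y \<ge> 256" for y
  proof -
    define M where "M = nat \<lfloor>y powr (1 / 8)\<rfloor>"
    have "2 = (256 :: real) powr (1 / 8)" using powr_powr[of 2 8 "1 / 8"] by simp
    also have "\<dots> \<le> y powr (1 / 8)" using y by (intro powr_mono2) auto
    finally have y2: "2 \<le> y powr (1 / 8)" .
    then have M: "M \<ge> 1" "real M \<le> y powr (1 / 8)" "y powr (1 / 8) - 1 \<le> real M" unfolding M_def by linarith+
    define A where "A = {n. \<exists>m p q. n = m\<^sup>2 * p * q \<and> 1 \<le> m \<and> m \<le> M \<and> (p = 1 \<or> prime p) \<and> prime q \<and> p < q \<and> real n \<le> y}"
    define C where "C = {n. \<exists>m>M. \<exists>k\<ge>1. n = m\<^sup>2 * k \<and> real n \<le> y}"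
    have A: "finite A" "real (card A) \<le> 96 * y / ln y * (4 + 2 * ln (ln y / ln 2))"
      using card_almost_square_small_square[of y M] y M unfolding A_def by auto
    have C: "finite C" "real (card C) \<le> y / M"
      using card_multiples_of_large_squares[of M y] y M unfolding C_def by auto
    have "{n \<in> almost_square. real n \<le> y} \<subseteq> A \<union> C"
    proof
      fix n assume "n \<in> {n \<in> almost_square. real n \<le> y}"
      then obtain m p q where n: "n = m\<^sup>2 * p * q" "m \<ge> 1" "p = 1 \<or> prime p" "prime q" "p < q" "real n \<le> y"
        unfolding almost_square_def by blast
      show "n \<in> A \<union> C"
      proof (cases "m \<le> M")
        case True
        then have "n \<in> A" unfolding A_def using n by blast
        then show ?thesis by simp
      next
        case False
        have "p * q \<ge> 1" using n by (auto simp: Suc_le_eq dest: prime_gt_0_nat)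
        then have "n \<in> C" unfolding C_def using n False by (auto simp: mult.assoc not_le)
        then show ?thesis by simp
      qed
    qed
    then have "card {n \<in> almost_square. real n \<le> y} \<le> card (A \<union> C)" using A C by (intro card_mono) auto
    also have "\<dots> \<le> card A + card C" by (rule card_Un_le)
    finally have "real (card {n \<in> almost_square. real n \<le> y}) \<le> real (card A) + real (card C)"
      by (simp flip: of_nat_add)
    moreover have "y / M \<le> y / (y powr (1 / 8) - 1)" using M y y2 by (intro divide_left_mono) auto
    ultimately show ?thesis using A C unfolding F_def by linarith
  qed
  then have "eventually (\<lambda>y. norm (real (card {n \<in> almost_square. real n \<le> y})) \<le> 1 * norm (F y)) at_top"
    by (intro eventually_mono[OF eventually_ge_at_top[of 256]]) (simp add: order_trans[OF _ abs_ge_self])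
  then have "(\<lambda>y. real (card {n \<in> almost_square. real n \<le> y})) \<in> O[at_top](F)" by (rule bigoI)
  also have "F \<in> O[at_top](\<lambda>y. y * ln (ln y) / ln y)" unfolding F_def by real_asymp
  finally show ?thesis .
qed

section \<open>The coefficients at exponents congruent to 7 modulo 16\<close>

lemma eq_square_mult_odd_primes:
  assumes "n > (0 :: nat)"
  shows "\<exists>m\<ge>1. n = m\<^sup>2 * \<Prod>{p \<in> prime_factors n. odd (multiplicity p n)}"
proof -
  \<comment> \<open>Halving each exponent and rounding down leaves one factor p exactly where the
    exponent is odd.\<close>
  define m where "m = (\<Prod>p\<in>prime_factors n. p ^ (multiplicity p n div 2))"
  have "n = (\<Prod>p\<in>prime_factors n. p ^ multiplicity p n)"
    using assms by (simp add: prime_factorization_nat)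
  also have "\<dots> = (\<Prod>p\<in>prime_factors n. (p ^ (multiplicity p n div 2))\<^sup>2 * (if odd (multiplicity p n) then p else 1))"
  proof (rule prod.cong[OF refl])
    fix p
    show "p ^ multiplicity p n = (p ^ (multiplicity p n div 2))\<^sup>2 * (if odd (multiplicity p n) then p else 1)"
      by (cases "odd (multiplicity p n)") (auto elim!: oddE evenE simp: power_mult power_mult_distrib mult.commute simp flip: power_mult)
  qed
  also have "\<dots> = m\<^sup>2 * \<Prod>{p \<in> prime_factors n. odd (multiplicity p n)}"
    by (simp add: prod.distrib m_def prod_power_distrib prod.inter_filter)
  finally have *: "n = m\<^sup>2 * \<Prod>{p \<in> prime_factors n. odd (multiplicity p n)}" .
  then have "m \<noteq> 0" using assms by (intro notI) simp
  then have "m \<ge> 1" by simp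
  with * show ?thesis by blast
qed

lemma not_mem_B:
  assumes n: "n mod 16 = 7" and three: "card {p \<in> prime_factors n. odd (multiplicity p n)} \<ge> 3"
  shows "n \<notin> B"
proof -
  have "n mod 4 = 3" "n mod 8 = 7" using n mod_mod_cancel[of 4 16 n] mod_mod_cancel[of 8 16 n] by simp_all
  then have "even (card (ternary_reps n))"
    using even_card_ternary_reps sixteen_dvd_divisor_sum three by blast
  then show ?thesis using mem_B_iff[OF n] by simp
qed

text \<open>\<open>not_mem_B\<close> leaves at most two primes of odd exponent, and n = 3 modulo 4
  guarantees at least one.\<close>

lemma mem_B_imp_almost_square:
  assumes n: "n mod 16 = 7" and "n \<in> B"
  shows "n \<in> almost_square"
proof -
  define E where "E = {p \<in> prime_factors n. odd (multiplicity p n)}"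
  have n4: "n mod 4 = 3" using n mod_mod_cancel[of 4 16 n] by simp
  have "n > 0" using n by (intro Nat.gr0I) simp
  then obtain m where m: "m \<ge> 1" "n = m\<^sup>2 * \<Prod>E" using eq_square_mult_odd_primes unfolding E_def by blast
  have prime: "prime p" if "p \<in> E" for p using that by (auto simp: E_def)
  have "card E < 3" using not_mem_B[OF n] assms(2) unfolding E_def by force
  moreover have "E \<noteq> {}"
  proof -
    obtain p where "prime p" "odd (multiplicity p n)" using exists_prime_3_mod_4[OF n4] by blast
    moreover from this have "p dvd n" by (metis even_zero not_dvd_imp_multiplicity_0)
    ultimately have "p \<in> E" using \<open>n > 0\<close> by (simp add: E_def prime_factors_dvd)
    then show ?thesis by blast
  qed
  moreover have "finite E" unfolding E_def by simp
  ultimately have "card E = 1 \<or> card E = 2" by (metis One_nat_def Suc_1 card_0_eq less_Suc_eq less_one numeral_3_eq_3 not_less_eq)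
  then obtain p q where "\<Prod>E = p * q" "p = 1 \<or> prime p" "prime q" "p < q"
  proof
    assume "card E = 1"
    then obtain q where "E = {q}" by (rule card_1_singletonE)
    then show ?thesis using that[of 1 q] prime prime_gt_1_nat by auto
  next
    assume "card E = 2"
    then obtain p q where "E = {p, q}" "p \<noteq> q" by (meson card_2_iff)
    then show ?thesis using that[of p q] that[of q p] prime by (cases "p < q") (auto simp: mult.commute)
  qed
  then show ?thesis unfolding almost_square_def using m by (auto simp: mult.assoc)
qed

theorem theorem3p11:
  shows "(\<forall>n::nat. [n = 7] (mod 16) \<and> card {p \<in> prime_factors n. odd (multiplicity p n)} \<ge> 3
            \<longrightarrow> n \<notin> B)
       \<and> (\<lambda>y::real. real (card {n \<in> B. real n \<le> y \<and> [n = 7] (mod 16)}))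
            \<in> O[at_top](\<lambda>y. y * ln (ln y) / ln y)"
proof
  show "\<forall>n::nat. [n = 7] (mod 16) \<and> card {p \<in> prime_factors n. odd (multiplicity p n)} \<ge> 3 \<longrightarrow> n \<notin> B"
    using not_mem_B by (simp add: unique_euclidean_semiring_class.cong_def)
  have "card {n \<in> B. real n \<le> y \<and> [n = 7] (mod 16)} \<le> card {n \<in> almost_square. real n \<le> y}" for y :: real
  proof (rule card_mono)
    have "{n \<in> almost_square. real n \<le> y} \<subseteq> {..nat \<lfloor>y\<rfloor>}" by (auto simp: le_nat_floor)
    then show "finite {n \<in> almost_square. real n \<le> y}" by (rule finite_subset) simp
    show "{n \<in> B. real n \<le> y \<and> [n = 7] (mod 16)} \<subseteq> {n \<in> almost_square. real n \<le> y}"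
      using mem_B_imp_almost_square by (auto simp: unique_euclidean_semiring_class.cong_def)
  qed
  then have "(\<lambda>y::real. real (card {n \<in> B. real n \<le> y \<and> [n = 7] (mod 16)})) \<in>
      O[at_top](\<lambda>y. real (card {n \<in> almost_square. real n \<le> y}))"
    by (intro landau_o.big_mono always_eventually) simp
  then show "(\<lambda>y::real. real (card {n \<in> B. real n \<le> y \<and> [n = 7] (mod 16)})) \<in>
      O[at_top](\<lambda>y. y * ln (ln y) / ln y)"
    using card_almost_square_bigo by (rule landau_o.big_trans)
qed

end
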